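(* Let $\theta\in[\tfrac12,1]$. Let $[\rho_h^n,\boldsymbol m_h^n,\mathcal E_h^n]^T\in\mathbb V_h^{d+2}$ be a discrete conserved state with positive nodal densities, $\varphi_h^n\in\mathbb H_{h,0}$, and let $[\rho_h^{n+1},\boldsymbol m_h^{n+1},\mathcal E_h^{n+1}]^T\in\mathbb V_h^{d+2}$, $\varphi_h^{n+1}\in\mathbb H_{h,0}$ be computed by the full source update procedure (described in the context). Then $$ \sum_{j,K}m_{j,K}\,\mathcal E_{j,K}^{n+1}+\frac{1}{2\alpha}\int_D\big|\nabla\varphi_h^{n+1}\big|_{\ell^2}^2\,\mathrm dx \ \le\ \sum_{j,K}m_{j,K}\,\mathcal E_{j,K}^{n}+\frac{1}{2\alpha}\int_D\big|\nabla\varphi_h^{n}\big|_{\ell^2}^2\,\mathrm dx , $$ with equality if $\theta=\tfrac12$. Furthermore, the nodal values of the density, $\rho_{j,K}^n$, and of the internal energy per unit volume, $\varepsilon_{j,K}^n=\mathcal E_{j,K}^n-\tfrac12|\boldsymbol m_{j,K}^n|_{\ell^2}^2/\rho_{j,K}^n$, are not modified by the update.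
   Context: $D\subset\mathbb R^d$, $d=2,3$, is an open, bounded, simply connected Lipschitz domain covered by a shape- and form-regular mesh $\mathcal T_h$ of quadrilateral ($d=2$) or hexahedral ($d=3$) cells $K$, each the image of $\widehat K=[0,1]^d$ under a diffeomorphism $\boldsymbol T_K$ (not necessarily affine). With $\mathbb Q_1$ the polynomials of degree at most 1 in each variable, set $\mathbb V_h=\{z_h\in L^2(D): z_h\circ\boldsymbol T_K\in\mathbb Q_1\ \forall K\in\mathcal T_h\}$, $\mathbb H_h=\{\psi_h\in C^0(D):\psi_h\circ\boldsymbol T_K\in\mathbb Q_1\ \forall K\in\mathcal T_h\}$ and $\mathbb H_{h,0}=\mathbb H_h\cap H_0^1(D)$ (homogeneous Dirichlet boundary conditions). $\{\phi_{j,K}\}$ is the nodal basis of $\mathbb V_h$, with nodes the vertices $\boldsymbol x_j$ of each cell $K$, and $m_{j,K}=\int_K\phi_{j,K}\,\mathrm dx>0$; sums $\sum_{j,K}$ run over all cells $K\in\mathcal T_h$ and all vertices $\boldsymbol x_j$ of $K$; subscripts $j,K$ denote nodal coefficients. For functions (scalar or vector valued) continuous on each cell up to its boundary, the lumped bilinear product is $\langle f,g\rangle_h=\sum_{j,K}m_{j,K}\,f|_K(\boldsymbol x_j)\cdot g|_K(\boldsymbol x_j)$, where $f|_K(\boldsymbol x_j)$ is the interior trace from $K$. Let $\alpha>0$, $\tau_n>0$, and let $\boldsymbol\Omega(\boldsymbol x)\in\mathbb R^{d_\ast}$ be a given field ($d_\ast=3$ if $d=3$; $d_\ast=1$ if $d=2$).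 For $d=2$, $\boldsymbol v\times\boldsymbol\Omega:=[v_2,-v_1]^T\Omega$. The (pointwise) invertible linear map $\mathcal B_{n,\theta}$ on $\mathbb R^d$ is $\mathcal B_{n,\theta}\boldsymbol v:=\boldsymbol v-\theta\tau_n\boldsymbol v\times\boldsymbol\Omega$, and $$a_h^{n,\theta}(\varphi_h,\psi_h):=(\nabla\varphi_h,\nabla\psi_h)_{L^2(D)^d}+\theta^2\tau_n^2\alpha\,\big\langle\rho_h^n\mathcal B_{n,\theta}^{-1}\nabla\varphi_h,\nabla\psi_h\big\rangle_h .$$ Full source update procedure: (1) Set $\boldsymbol v_h^n\in\mathbb V_h^d$ and $\varepsilon_h^n\in\mathbb V_h$ by $\boldsymbol v_{j,K}^n:=\boldsymbol m_{j,K}^n/\rho_{j,K}^n$ and $\varepsilon_{j,K}^n:=\mathcal E_{j,K}^n-\tfrac12|\boldsymbol m_{j,K}^n|_{\ell^2}^2/\rho_{j,K}^n$. (2) Compute $\boldsymbol v_h^{n+1}\in\mathbb V_h^d$, $\varphi_h^{n+1}\in\mathbb H_{h,0}$ by solving for $\varphi_h^{n+\theta}\in\mathbb H_{h,0}$, $\boldsymbol v_h^{n+\theta}\in\mathbb V_h^d$: $$ \begin{cases} a_h^{n,\theta}(\varphi_h^{n+\theta},\psi_h)=(\nabla\varphi_h^n,\nabla\psi_h)_{L^2(D)^d}+\theta\tau_n\alpha\,\big\langle\rho_h^n\mathcal B_{n,\theta}^{-1}\boldsymbol v_h^n,\nabla\psi_h\big\rangle_h & \forall\,\psi_h\in\mathbb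 H_{h,0},\\ \langle\boldsymbol v_h^{n+\theta},\boldsymbol z_h\rangle_h=\big\langle\mathcal B_{n,\theta}^{-1}\big(\boldsymbol v_h^n-\theta\tau_n\nabla\varphi_h^{n+\theta}\big),\boldsymbol z_h\big\rangle_h & \forall\,\boldsymbol z_h\in\mathbb V_h^d, \end{cases} $$ and setting $\theta\,\boldsymbol v_h^{n+1}=\boldsymbol v_h^{n+\theta}-(1-\theta)\boldsymbol v_h^n$, $\theta\,\varphi_h^{n+1}=\varphi_h^{n+\theta}-(1-\theta)\varphi_h^n$. (3) Set $\boldsymbol m_{j,K}^{n+1}:=\rho_{j,K}^n\boldsymbol v_{j,K}^{n+1}$ and $\mathcal E_{j,K}^{n+1}:=\varepsilon_{j,K}^n+\tfrac12\rho_{j,K}^n|\boldsymbol v_{j,K}^{n+1}|_{\ell^2}^2$. (4) Set $\rho_h^{n+1}=\rho_h^n$. $|\cdot|_{\ell^2}$ is the Euclidean norm. *)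

theory Defs
  imports "HOL-Analysis.Analysis"
begin

text \<open>
  Every notion below is stated on \<open>real^'d\<close> for an arbitrary finite index type; the theorem uses
  \<open>'d = 2\<close> and \<open>'d = 3\<close>.  The only ingredient that really depends on the dimension, the product
  \<open>v \<times> \<Omega>\<close>, is the argument \<open>crs\<close>, instantiated with \<open>cross2\<close> below and with the library's
  \<open>cross3\<close>.
\<close>

definition cross2 :: "real^2 \<Rightarrow> real \<Rightarrow> real^2" where
  "cross2 v \<omega> = \<omega> *\<^sub>R vector [v $ 2, - v $ 1]"


section \<open>Domain and function spaces on it\<close>

text \<open>Near each boundary point, \<open>D\<close> is, in suitable orthonormal coordinates with \<open>e\<close> as last axis,
  the part above the graph of a Lipschitz function \<open>g\<close> of the remaining coordinates.\<close>

definition lipschitz_domain :: "'a::euclidean_space set \<Rightarrow> bool" where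
  "lipschitz_domain D \<longleftrightarrow>
     (\<forall>p\<in>frontier D. \<exists>U e L g.
        open U \<and> p \<in> U \<and> norm e = 1 \<and> L-lipschitz_on {y. y \<bullet> e = 0} g \<and>
        D \<inter> U = {x \<in> U. g (x - (x \<bullet> e) *\<^sub>R e) < x \<bullet> e})"

text \<open>The gradient is the classical one.  A function of the continuous finite element space is
  continuous and continuously differentiable in the interior of every cell, so that its classical
  gradient exists outside the null set of cell boundaries and coincides almost everywhere with the
  weak gradient.\<close>

definition grad :: "('a::euclidean_space \<Rightarrow> real) \<Rightarrow> 'a \<Rightarrow> 'a" where
  "grad f x = (THE g. GDERIV f x :> g)"

definition L2 :: "'a::euclidean_space set \<Rightarrow> ('a \<Rightarrow> real) set" where
  "L2 D = {f. f \<in> borel_measurable (lebesgue_on D) \<and> integrable (lebesgue_on D) (\<lambda>x. (f x)\<^sup>2)}"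

definition grad_inner :: "'a::euclidean_space set \<Rightarrow> ('a \<Rightarrow> real) \<Rightarrow> ('a \<Rightarrow> real) \<Rightarrow> real" where
  "grad_inner D \<phi> \<psi> = (LINT x:D|lebesgue. grad \<phi> x \<bullet> grad \<psi> x)"

text \<open>\<open>k\<close> times continuously differentiable on the whole space.\<close>

primrec Ck :: "nat \<Rightarrow> (real^'d \<Rightarrow> real) \<Rightarrow> bool" where
  "Ck 0 f \<longleftrightarrow> continuous_on UNIV f"
| "Ck (Suc k) f \<longleftrightarrow>
     (\<exists>g :: real^'d \<Rightarrow> real^'d. (\<forall>x. GDERIV f x :> g x) \<and> (\<forall>i. Ck k (\<lambda>x. g x $ i)))"

definition test_functions :: "(real^'d) set \<Rightarrow> (real^'d \<Rightarrow> real) set" where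
  "test_functions D =
     {w. (\<forall>k. Ck k w) \<and> compact (closure {x. w x \<noteq> 0}) \<and> closure {x. w x \<noteq> 0} \<subseteq> D}"

text \<open>\<open>H\<^sub>0\<^sup>1(D)\<close> as the closure of the test functions in the \<open>H\<^sup>1\<close> norm; \<open>g\<close> is the weak gradient
  of \<open>u\<close>.\<close>

definition H10 :: "(real^'d) set \<Rightarrow> (real^'d \<Rightarrow> real) set" where
  "H10 D = {u. u \<in> L2 D \<and>
     (\<exists>(g :: real^'d \<Rightarrow> real^'d) w.
        (\<forall>i. (\<lambda>x. g x $ i) \<in> L2 D) \<and> (\<forall>k::nat. w k \<in> test_functions D) \<and>
        (\<lambda>k. LINT x:D|lebesgue. (u x - w k x)\<^sup>2 + (norm (g x - grad (w k) x))\<^sup>2) \<longlonglongrightarrow> 0)}"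


section \<open>Meshes\<close>

definition ref_cell :: "(real^'d) set" where
  "ref_cell = cbox 0 1"

text \<open>\<open>f\<close> is continuously differentiable on \<open>S\<close>, up to the boundary if \<open>S\<close> is closed, with
  derivative \<open>f'\<close>.\<close>

definition C1_with :: "'a::real_normed_vector set \<Rightarrow> ('a \<Rightarrow> 'b::real_normed_vector) \<Rightarrow>
    ('a \<Rightarrow> 'a \<Rightarrow>\<^sub>L 'b) \<Rightarrow> bool" where
  "C1_with S f f' \<longleftrightarrow>
     (\<forall>x\<in>S. (f has_derivative blinfun_apply (f' x)) (at x within S)) \<and> continuous_on S f'"

text \<open>A \<open>C\<^sup>1\<close> diffeomorphism from the closed reference cell onto the closed cell \<open>K\<close>.  The constant
  \<open>\<kappa>\<close> quantifies regularity: the cell contains a ball of comparable size, and the condition of the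
  Jacobian of the cell map is bounded.\<close>

definition cell_map :: "real \<Rightarrow> (real^'d) set \<Rightarrow> (real^'d \<Rightarrow> real^'d) \<Rightarrow> bool" where
  "cell_map \<kappa> K F \<longleftrightarrow>
     (\<exists>G F' G'. homeomorphism ref_cell K F G \<and> C1_with ref_cell F F' \<and> C1_with K G G' \<and>
        (\<forall>x\<in>ref_cell. \<forall>y\<in>K. norm (F' x) * norm (G' y) \<le> \<kappa>)) \<and>
     (\<exists>c r. 0 < r \<and> ball c r \<subseteq> K \<and> diameter K \<le> \<kappa> * r)"

text \<open>\<open>Th\<close> is the set of cells and \<open>T K\<close> the map of the cell \<open>K\<close>.\<close>

definition regular_mesh :: "real \<Rightarrow> (real^'d) set \<Rightarrow> (real^'d) set set \<Rightarrow>
    ((real^'d) set \<Rightarrow> real^'d \<Rightarrow> real^'d) \<Rightarrow> bool" where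
  "regular_mesh \<kappa> D Th T \<longleftrightarrow>
     finite Th \<and> \<Union>Th = closure D \<and>
     pairwise (\<lambda>K K'. interior K \<inter> interior K' = {}) Th \<and>
     (\<forall>K\<in>Th. cell_map \<kappa> K (T K))"

definition vertices :: "((real^'d) set \<Rightarrow> real^'d \<Rightarrow> real^'d) \<Rightarrow> (real^'d) set \<Rightarrow> (real^'d) set" where
  "vertices T K = T K ` {\<xi>. \<forall>i. \<xi> $ i = 0 \<or> \<xi> $ i = 1}"

text \<open>The interior trace \<open>f|\<^sub>K(x)\<close>.\<close>

definition trace_in :: "'a::euclidean_space set \<Rightarrow> ('a \<Rightarrow> 'b::t2_space) \<Rightarrow> 'a \<Rightarrow> 'b" where
  "trace_in K f x = Lim (at x within interior K) f"

definition cellwise_continuous :: "'a::euclidean_space set set \<Rightarrow> ('a \<Rightarrow> 'b::t2_space) \<Rightarrow> bool" where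
  "cellwise_continuous Th f \<longleftrightarrow>
     (\<forall>K\<in>Th. \<exists>g. continuous_on K g \<and> (\<forall>x\<in>interior K. f x = g x))"

text \<open>Equality of cellwise continuous functions as elements of \<open>L\<^sup>2\<close>: values on the cell boundaries
  are immaterial.\<close>

definition cellwise_eq :: "'a::euclidean_space set set \<Rightarrow> ('a \<Rightarrow> 'b) \<Rightarrow> ('a \<Rightarrow> 'b) \<Rightarrow> bool" where
  "cellwise_eq Th f g \<longleftrightarrow> (\<forall>K\<in>Th. \<forall>x\<in>interior K. f x = g x)"


section \<open>Finite element spaces\<close>

definition Q1 :: "(real^'d \<Rightarrow> real) set" where
  "Q1 = {q. \<exists>c :: 'd set \<Rightarrow> real. \<forall>x. q x = (\<Sum>S\<in>UNIV. c S * (\<Prod>i\<in>S. x $ i))}"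

definition cellwise_Q1 :: "(real^'d) set set \<Rightarrow> ((real^'d) set \<Rightarrow> real^'d \<Rightarrow> real^'d) \<Rightarrow>
    (real^'d \<Rightarrow> real) \<Rightarrow> bool" where
  "cellwise_Q1 Th T f \<longleftrightarrow> (\<forall>K\<in>Th. \<exists>q\<in>Q1. \<forall>\<xi>\<in>interior ref_cell. f (T K \<xi>) = q \<xi>)"

text \<open>Elements of the discontinuous space \<open>Vh\<close> are represented by functions that agree with the
  transported polynomial in the interior of every cell; their values on cell boundaries are
  arbitrary.\<close>

definition Vh :: "(real^'d) set \<Rightarrow> (real^'d) set set \<Rightarrow> ((real^'d) set \<Rightarrow> real^'d \<Rightarrow> real^'d) \<Rightarrow>
    (real^'d \<Rightarrow> real) set" where
  "Vh D Th T = {z \<in> L2 D. cellwise_Q1 Th T z}"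

definition Vh_vec :: "(real^'d) set \<Rightarrow> (real^'d) set set \<Rightarrow> ((real^'d) set \<Rightarrow> real^'d \<Rightarrow> real^'d) \<Rightarrow>
    (real^'d \<Rightarrow> real^'d) set" where
  "Vh_vec D Th T = {z. \<forall>i. (\<lambda>x. z x $ i) \<in> Vh D Th T}"

definition Hh :: "(real^'d) set \<Rightarrow> (real^'d) set set \<Rightarrow> ((real^'d) set \<Rightarrow> real^'d \<Rightarrow> real^'d) \<Rightarrow>
    (real^'d \<Rightarrow> real) set" where
  "Hh D Th T = {\<psi>. continuous_on D \<psi> \<and> cellwise_Q1 Th T \<psi>}"

definition Hh0 :: "(real^'d) set \<Rightarrow> (real^'d) set set \<Rightarrow> ((real^'d) set \<Rightarrow> real^'d \<Rightarrow> real^'d) \<Rightarrow>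
    (real^'d \<Rightarrow> real) set" where
  "Hh0 D Th T = Hh D Th T \<inter> H10 D"

text \<open>The nodal basis function of \<open>Vh\<close> that belongs to the vertex \<open>x\<close> of the cell \<open>K\<close>: on \<open>K\<close> it is
  the transported product of one-dimensional hat functions which is \<open>1\<close> at \<open>x\<close> and \<open>0\<close> at the other
  vertices of \<open>K\<close>; it vanishes outside \<open>K\<close>.\<close>

definition nodal_basis :: "((real^'d) set \<Rightarrow> real^'d \<Rightarrow> real^'d) \<Rightarrow> (real^'d) set \<Rightarrow> real^'d \<Rightarrow>
    real^'d \<Rightarrow> real" where
  "nodal_basis T K x y =
     (if y \<in> K then
        (let c = inv_into ref_cell (T K) x; \<xi> = inv_into ref_cell (T K) y
         in \<Prod>i\<in>UNIV. if c $ i = 1 then \<xi> $ i else 1 - \<xi> $ i)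
      else 0)"

definition lumped_mass :: "((real^'d) set \<Rightarrow> real^'d \<Rightarrow> real^'d) \<Rightarrow> (real^'d) set \<Rightarrow> real^'d \<Rightarrow>
    real" where
  "lumped_mass T K x = (LINT y:K|lebesgue. nodal_basis T K x y)"

text \<open>Meaningful only for cellwise continuous arguments, for which the interior traces exist; the
  field \<open>\<Omega>\<close> of the source update is therefore taken to be cellwise continuous.\<close>

definition lumped :: "(real^'d) set set \<Rightarrow> ((real^'d) set \<Rightarrow> real^'d \<Rightarrow> real^'d) \<Rightarrow>
    (real^'d \<Rightarrow> 'b::real_inner) \<Rightarrow> (real^'d \<Rightarrow> 'b) \<Rightarrow> real" where
  "lumped Th T f g =
     (\<Sum>K\<in>Th. \<Sum>x\<in>vertices T K. lumped_mass T K x * (trace_in K f x \<bullet> trace_in K g x))"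


section \<open>The source update\<close>

definition Bmap :: "(real^'d \<Rightarrow> 'w \<Rightarrow> real^'d) \<Rightarrow> (real^'d \<Rightarrow> 'w) \<Rightarrow> real \<Rightarrow> real \<Rightarrow>
    real^'d \<Rightarrow> real^'d \<Rightarrow> real^'d" where
  "Bmap crs \<Omega> \<tau> \<theta> x v = v - (\<theta> * \<tau>) *\<^sub>R crs v (\<Omega> x)"

definition Binv :: "(real^'d \<Rightarrow> 'w \<Rightarrow> real^'d) \<Rightarrow> (real^'d \<Rightarrow> 'w) \<Rightarrow> real \<Rightarrow> real \<Rightarrow>
    (real^'d \<Rightarrow> real^'d) \<Rightarrow> real^'d \<Rightarrow> real^'d" where
  "Binv crs \<Omega> \<tau> \<theta> f x = inv (Bmap crs \<Omega> \<tau> \<theta> x) (f x)"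

definition a_form :: "(real^'d) set \<Rightarrow> (real^'d) set set \<Rightarrow> ((real^'d) set \<Rightarrow> real^'d \<Rightarrow> real^'d) \<Rightarrow>
    (real^'d \<Rightarrow> 'w \<Rightarrow> real^'d) \<Rightarrow> (real^'d \<Rightarrow> 'w) \<Rightarrow> real \<Rightarrow> real \<Rightarrow> real \<Rightarrow> (real^'d \<Rightarrow> real) \<Rightarrow>
    (real^'d \<Rightarrow> real) \<Rightarrow> (real^'d \<Rightarrow> real) \<Rightarrow> real" where
  "a_form D Th T crs \<Omega> \<alpha> \<tau> \<theta> \<rho> \<phi> \<psi> =
     grad_inner D \<phi> \<psi> +
     \<theta>\<^sup>2 * \<tau>\<^sup>2 * \<alpha> * lumped Th T (\<lambda>x. \<rho> x *\<^sub>R Binv crs \<Omega> \<tau> \<theta> (grad \<phi>) x) (grad \<psi>)"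

text \<open>\<open>\<rho>, m, E, \<phi>\<close> is the old state and potential and \<open>\<rho>', m', E', \<phi>'\<close> the result of the update;
  \<open>v\<theta>\<close>, \<open>\<phi>\<theta>\<close> are the intermediate quantities at time level \<open>n + \<theta>\<close>.\<close>

definition source_update :: "(real^'d) set \<Rightarrow> (real^'d) set set \<Rightarrow>
    ((real^'d) set \<Rightarrow> real^'d \<Rightarrow> real^'d) \<Rightarrow> (real^'d \<Rightarrow> 'w \<Rightarrow> real^'d) \<Rightarrow> (real^'d \<Rightarrow> 'w) \<Rightarrow>
    real \<Rightarrow> real \<Rightarrow> real \<Rightarrow>
    (real^'d \<Rightarrow> real) \<Rightarrow> (real^'d \<Rightarrow> real^'d) \<Rightarrow> (real^'d \<Rightarrow> real) \<Rightarrow> (real^'d \<Rightarrow> real) \<Rightarrow>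
    (real^'d \<Rightarrow> real) \<Rightarrow> (real^'d \<Rightarrow> real^'d) \<Rightarrow> (real^'d \<Rightarrow> real) \<Rightarrow> (real^'d \<Rightarrow> real) \<Rightarrow> bool" where
  "source_update D Th T crs \<Omega> \<alpha> \<tau> \<theta> \<rho> m E \<phi> \<rho>' m' E' \<phi>' \<longleftrightarrow>
     (\<exists>v\<in>Vh_vec D Th T. \<exists>\<epsilon>\<in>Vh D Th T. \<exists>\<phi>\<theta>\<in>Hh0 D Th T. \<exists>v\<theta>\<in>Vh_vec D Th T. \<exists>v'\<in>Vh_vec D Th T.
        \<comment> \<open>velocity and internal energy\<close>
        (\<forall>K\<in>Th. \<forall>x\<in>vertices T K.
           trace_in K v x = trace_in K m x /\<^sub>R trace_in K \<rho> x \<and>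
           trace_in K \<epsilon> x =
             trace_in K E x - 1/2 * (norm (trace_in K m x))\<^sup>2 / trace_in K \<rho> x) \<and>
        \<comment> \<open>discrete equations and extrapolation to the new time level\<close>
        (\<forall>\<psi>\<in>Hh0 D Th T.
           a_form D Th T crs \<Omega> \<alpha> \<tau> \<theta> \<rho> \<phi>\<theta> \<psi> =
           grad_inner D \<phi> \<psi> +
           \<theta> * \<tau> * \<alpha> * lumped Th T (\<lambda>x. \<rho> x *\<^sub>R Binv crs \<Omega> \<tau> \<theta> v x) (grad \<psi>)) \<and>
        (\<forall>z\<in>Vh_vec D Th T.
           lumped Th T v\<theta> z =
           lumped Th T (Binv crs \<Omega> \<tau> \<theta> (\<lambda>x. v x - (\<theta> * \<tau>) *\<^sub>R grad \<phi>\<theta> x)) z) \<and>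
        cellwise_eq Th (\<lambda>x. \<theta> *\<^sub>R v' x) (\<lambda>x. v\<theta> x - (1 - \<theta>) *\<^sub>R v x) \<and>
        \<phi>' \<in> Hh0 D Th T \<and> (\<forall>x\<in>D. \<theta> * \<phi>' x = \<phi>\<theta> x - (1 - \<theta>) * \<phi> x) \<and>
        \<comment> \<open>momentum and total energy\<close>
        m' \<in> Vh_vec D Th T \<and> E' \<in> Vh D Th T \<and>
        (\<forall>K\<in>Th. \<forall>x\<in>vertices T K.
           trace_in K m' x = trace_in K \<rho> x *\<^sub>R trace_in K v' x \<and>
           trace_in K E' x =
             trace_in K \<epsilon> x + 1/2 * trace_in K \<rho> x * (norm (trace_in K v' x))\<^sup>2) \<and>
        \<comment> \<open>density\<close>
        \<rho>' \<in> Vh D Th T \<and> cellwise_eq Th \<rho>' \<rho>)"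

definition total_energy :: "(real^'d) set \<Rightarrow> (real^'d) set set \<Rightarrow>
    ((real^'d) set \<Rightarrow> real^'d \<Rightarrow> real^'d) \<Rightarrow> real \<Rightarrow> (real^'d \<Rightarrow> real) \<Rightarrow> (real^'d \<Rightarrow> real) \<Rightarrow>
    real" where
  "total_energy D Th T \<alpha> E \<phi> =
     (\<Sum>K\<in>Th. \<Sum>x\<in>vertices T K. lumped_mass T K x * trace_in K E x) +
     1 / (2 * \<alpha>) * (LINT x:D|lebesgue. (norm (grad \<phi> x))\<^sup>2)"

end

theory Submission
  imports Defs
begin

text \<open>
  The update is a \<open>\<theta>\<close>-scheme, and both halves of the energy are quadratic.  For a quadratic form,
  if \<open>\<theta> u' = u\<^sub>\<theta> - (1 - \<theta>) u\<close>, then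
  \<open>\<theta>\<^sup>2 (|u'|\<^sup>2 - |u|\<^sup>2) = 2 \<theta> (u\<^sub>\<theta> - u) \<bullet> u\<^sub>\<theta> - (2 \<theta> - 1) |u\<^sub>\<theta> - u|\<^sup>2\<close>:
  the increment is the power evaluated at the intermediate level, minus a dissipation term that has a
  sign for \<open>\<theta> \<ge> 1/2\<close> and vanishes for \<open>\<theta> = 1/2\<close>.  It remains to see that the two powers cancel.

  At a node, the velocity equation says \<open>v\<^sub>\<theta> - v = \<theta>\<tau> v\<^sub>\<theta> \<times> \<Omega> - \<theta>\<tau> \<nabla>\<phi>\<^sub>\<theta>\<close>.  The rotation does no
  work because \<open>v\<^sub>\<theta> \<times> \<Omega>\<close> is orthogonal to \<open>v\<^sub>\<theta>\<close>; the kinetic power is therefore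
  \<open>-\<theta>\<tau> \<rho> v\<^sub>\<theta> \<bullet> \<nabla>\<phi>\<^sub>\<theta>\<close>, summed over the nodes with the lumped masses
  (\<open>kinetic_energy_increment\<close>).  The potential equation, tested with \<open>\<phi>\<^sub>\<theta>\<close> itself, says that the power
  of the field is \<open>\<theta>\<tau>\<alpha>\<close> times the lumped product of \<open>\<rho> v\<^sub>\<theta>\<close> and \<open>\<nabla>\<phi>\<^sub>\<theta>\<close>, because its two lumped
  terms combine, by linearity of the inverse rotation, to the nodal value of \<open>v\<^sub>\<theta>\<close>.  Dividing by
  \<open>\<alpha>\<close> gives the opposite of the kinetic power.  The result is the exact balance
  \<open>source_update_energy_balance\<close>.

  The remaining work makes the nodal computation legitimate.  Cell maps are diffeomorphisms up to the
  boundary; hence finite element functions and their gradients extend continuously to closed cells,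
  interior traces at vertices are limits that commute with algebraic operations and with the inverse
  rotation, and gradients are square integrable since the mesh skeleton is a null set.  The velocity
  equation, which is posed against test functions, becomes a nodal identity by inserting the nodal
  basis (\<open>lumped_eq_imp_trace_eq\<close>).

  The dimension enters only through the product \<open>v \<times> \<Omega>\<close>.  The argument is carried out in any
  dimension for a bounded bilinear product with \<open>(v \<times> \<Omega>) \<bullet> v = 0\<close> (locale \<open>skew_product\<close>), and the
  two- and three-dimensional products are instances.
\<close>

section \<open>Cells, faces and vertices\<close>

lemma cell_map_obtain:
  assumes "cell_map \<kappa> K F"
  obtains G F' G' where "homeomorphism ref_cell K F G" "C1_with ref_cell F F'" "C1_with K G G'"
  using assms unfolding cell_map_def by blast

text \<open>Invariance of domain, applied to the homeomorphism and to its inverse.\<close>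

lemma homeomorphism_image_interior:
  fixes F G :: "'a::euclidean_space \<Rightarrow> 'a"
  assumes h: "homeomorphism S K F G"
  shows "F ` interior S = interior K"
proof -
  have le: "f ` interior A \<subseteq> interior B" if "homeomorphism A B f g"
    for A B and f g :: "'a \<Rightarrow> 'a"
  proof (rule interior_maximal)
    show "f ` interior A \<subseteq> B"
      using interior_subset homeomorphism_image1[OF that] by blast
    have "inj_on f A"
      by (rule inj_on_inverseI[of _ g]) (rule homeomorphism_apply1[OF that])
    then have "inj_on f (interior A)"
      by (rule inj_on_subset) (rule interior_subset)
    moreover have "continuous_on (interior A) f"
      using homeomorphism_cont1[OF that] interior_subset by (rule continuous_on_subset)
    ultimately show "open (f ` interior A)"
      by (intro invariance_of_domain open_interior)
  qed
  show ?thesis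
  proof (intro equalityI le[OF h] subsetI)
    fix y assume y: "y \<in> interior K"
    then have "y = F (G y)"
      using homeomorphism_apply2[OF h] interior_subset by (metis subsetD)
    moreover have "G y \<in> interior S"
      using le[OF homeomorphism_symD[OF h]] y by blast
    ultimately show "y \<in> F ` interior S"
      by (rule image_eqI)
  qed
qed

lemma ref_cell_closure_interior: "closure (interior ref_cell) = (ref_cell :: (real^'d) set)"
proof -
  have "box (0 :: real^'d) 1 \<noteq> {}"
    by (auto simp: box_ne_empty Basis_vec_def inner_axis)
  then show ?thesis
    by (simp add: ref_cell_def closure_box)
qed

text \<open>The use of this inclusion: every vertex is a limit point of the interior of its cell, so that an
  interior trace is unique.\<close>

lemma cell_subset_closure_interior:
  assumes "cell_map \<kappa> K F"
  shows "K \<subseteq> closure (interior K)"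
proof -
  obtain G where h: "homeomorphism ref_cell K F G"
    using assms by (rule cell_map_obtain)
  then have "continuous_on (closure (interior ref_cell)) F"
    by (simp add: ref_cell_closure_interior homeomorphism_def)
  then have "F ` closure (interior ref_cell) \<subseteq> closure (interior K)"
    by (rule image_closure_subset)
      (auto simp: homeomorphism_image_interior[OF h] intro: closure_subset[THEN subsetD])
  then show ?thesis
    using h by (simp add: ref_cell_closure_interior homeomorphism_def)
qed

lemma compact_cell:
  assumes "cell_map \<kappa> K F"
  shows "compact K"
proof -
  obtain G where h: "homeomorphism ref_cell K F G"
    using assms by (rule cell_map_obtain)
  have "compact (ref_cell :: (real^'a) set)"
    by (simp add: ref_cell_def compact_cbox)
  then show ?thesis
    using h compact_continuous_image unfolding homeomorphism_def by metis
qed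

text \<open>The boundary of a cell is the image of the boundary of the cube under a map that is
  differentiable there, and differentiable maps preserve null sets.\<close>

lemma negligible_frontier_cell:
  assumes "cell_map \<kappa> K F"
  shows "negligible (frontier K)"
proof -
  obtain G F' where h: "homeomorphism ref_cell K F G" and d: "C1_with ref_cell F F'"
    using assms by (rule cell_map_obtain)
  have "negligible (ref_cell - interior ref_cell :: (real^'a) set)"
    by (simp add: ref_cell_def negligible_frontier_interval)
  moreover have "F differentiable_on (ref_cell - interior ref_cell)"
    using d unfolding C1_with_def differentiable_on_def differentiable_def
    by (meson Diff_subset has_derivative_subset subsetD)
  ultimately have "negligible (F ` (ref_cell - interior ref_cell))"
    by (intro negligible_differentiable_image_negligible) auto
  moreover have "frontier K \<subseteq> F ` (ref_cell - interior ref_cell)"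
  proof
    fix y assume y: "y \<in> frontier K"
    then have "y \<in> K" "y \<notin> interior K"
      using compact_cell[OF assms] by (auto simp: frontier_def compact_imp_closed)
    then obtain \<xi> where "\<xi> \<in> ref_cell" "y = F \<xi>"
      using h by (auto simp: homeomorphism_def)
    with \<open>y \<notin> interior K\<close> show "y \<in> F ` (ref_cell - interior ref_cell)"
      using homeomorphism_image_interior[OF h] by blast
  qed
  ultimately show ?thesis
    by (rule negligible_subset)
qed

lemma mesh_cell: "regular_mesh \<kappa> D Th T \<Longrightarrow> K \<in> Th \<Longrightarrow> cell_map \<kappa> K (T K)"
  by (simp add: regular_mesh_def)

lemma negligible_skeleton:
  assumes "regular_mesh \<kappa> D Th T"
  shows "negligible (\<Union>K\<in>Th. frontier K)"
proof (rule negligible_Union)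
  show "finite (frontier ` Th)"
    using assms by (simp add: regular_mesh_def)
  show "negligible N" if "N \<in> frontier ` Th" for N
    using that negligible_frontier_cell[OF mesh_cell[OF assms]] by blast
qed

lemma skeleton_complement:
  assumes "regular_mesh \<kappa> D Th T" "x \<in> D - (\<Union>K\<in>Th. frontier K)"
  obtains K where "K \<in> Th" "x \<in> interior K"
proof -
  have "x \<in> \<Union>Th"
    using assms closure_subset[of D] by (auto simp: regular_mesh_def)
  then obtain K where "K \<in> Th" "x \<in> K"
    by blast
  moreover then have "x \<in> interior K"
    using assms(2) closure_subset[of K] by (auto simp: frontier_def)
  ultimately show ?thesis
    using that by blast
qed

lemma corner_in_ref_cell:
  assumes "\<forall>i. \<xi> $ i = 0 \<or> \<xi> $ i = 1"
  shows "\<xi> \<in> ref_cell"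
  unfolding ref_cell_def mem_box_cart
proof
  fix i show "(0::real^'a) $ i \<le> \<xi> $ i \<and> \<xi> $ i \<le> (1::real^'a) $ i"
    using assms[rule_format, of i] by auto
qed

lemma finite_vertices: "finite (vertices T (K :: (real^'d) set))"
proof -
  have "{\<xi> :: real^'d. \<forall>i. \<xi> $ i = 0 \<or> \<xi> $ i = 1} \<subseteq> (\<lambda>S. \<chi> i. if i \<in> S then 1 else 0) ` UNIV"
  proof
    fix \<xi> :: "real^'d" assume "\<xi> \<in> {\<xi>. \<forall>i. \<xi> $ i = 0 \<or> \<xi> $ i = 1}"
    then have "\<xi> = (\<chi> i. if i \<in> {i. \<xi> $ i = 1} then 1 else 0)"
      by (auto simp: vec_eq_iff)
    then show "\<xi> \<in> (\<lambda>S. \<chi> i. if i \<in> S then 1 else 0) ` UNIV"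
      by blast
  qed
  then show ?thesis
    unfolding vertices_def by (intro finite_imageI) (rule finite_subset, auto)
qed

lemma vertex_in_cell:
  assumes "cell_map \<kappa> K (T K)" and "x \<in> vertices T K"
  shows "x \<in> K"
proof -
  obtain G where h: "homeomorphism ref_cell K (T K) G"
    using assms(1) by (rule cell_map_obtain)
  from homeomorphism_image1[OF this] show ?thesis
    using assms(2) corner_in_ref_cell by (fastforce simp: vertices_def)
qed

section \<open>Interior traces\<close>

lemma trace_in_eqI:
  assumes K: "cell_map \<kappa> K (T K)" and x: "x \<in> vertices T K"
    and lim: "(f \<longlongrightarrow> l) (at x within interior K)"
  shows "trace_in K f x = l"
proof -
  have "x \<in> closure (interior K)"
    using cell_subset_closure_interior[OF K] vertex_in_cell[OF K x] by blast
  then have "x islimpt interior K"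
    using interior_limit_point[of x "interior K"] by (auto simp: closure_def)
  then show ?thesis
    unfolding trace_in_def using lim by (intro tendsto_Lim) (auto simp: trivial_limit_within)
qed

lemma tendsto_continuous_extension:
  assumes K: "cell_map \<kappa> K (T K)" and x: "x \<in> vertices T K"
    and g: "continuous_on K g" and eq: "\<And>y. y \<in> interior K \<Longrightarrow> f y = g y"
  shows "(f \<longlongrightarrow> g x) (at x within interior K)"
proof -
  have "(g \<longlongrightarrow> g x) (at x within interior K)"
    using g vertex_in_cell[OF K x] interior_subset[of K]
    by (meson continuous_on_def tendsto_within_subset)
  then show ?thesis
    by (rule Lim_transform_within[where d=1]) (auto simp: eq)
qed

text \<open>For cellwise continuous functions the interior trace is a genuine limit and not an unspecified
  value; limit rules then compute the traces of sums, products and inverse rotations.\<close>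

lemma cellwise_continuous_tendsto:
  assumes "cellwise_continuous Th f" "K \<in> Th"
    and K: "cell_map \<kappa> K (T K)" and x: "x \<in> vertices T K"
  shows "(f \<longlongrightarrow> trace_in K f x) (at x within interior K)"
proof -
  obtain g where g: "continuous_on K g" "\<And>y. y \<in> interior K \<Longrightarrow> f y = g y"
    using assms(1,2) unfolding cellwise_continuous_def by blast
  have lim: "(f \<longlongrightarrow> g x) (at x within interior K)"
    using K x g by (rule tendsto_continuous_extension)
  from trace_in_eqI[where T=T, OF K x this] show ?thesis
    using lim by simp
qed

lemma trace_in_cong:
  assumes "\<And>y. y \<in> interior K \<Longrightarrow> f y = g y"
  shows "trace_in K f x = trace_in K g x"
proof -
  have "(f \<longlongrightarrow> l) (at x within interior K) \<longleftrightarrow> (g \<longlongrightarrow> l) (at x within interior K)" for l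
    by (rule Lim_cong_within) (auto simp: assms)
  then show ?thesis
    by (simp add: trace_in_def Topological_Spaces.Lim_def)
qed

section \<open>Finite element functions are smooth up to the boundary of each cell\<close>

lemma Q1_gradient:
  assumes "q \<in> Q1"
  obtains g :: "real^'d \<Rightarrow> real^'d" where "\<forall>\<xi>. GDERIV q \<xi> :> g \<xi>" "continuous_on UNIV g"
proof -
  obtain c :: "'d set \<Rightarrow> real" where q: "\<And>x. q x = (\<Sum>S\<in>UNIV. c S * (\<Prod>i\<in>S. x $ i))"
    using assms unfolding Q1_def by blast
  define g :: "real^'d \<Rightarrow> real^'d" where
    "g = (\<lambda>x. \<Sum>S\<in>UNIV. c S *\<^sub>R (\<Sum>i\<in>S. (\<Prod>j\<in>S-{i}. x $ j) *\<^sub>R axis i 1))"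
  have "GDERIV q x :> g x" for x
  proof -
    have "((\<lambda>x. \<Sum>S\<in>UNIV. c S * (\<Prod>i\<in>S. x $ i)) has_derivative
        (\<lambda>h. \<Sum>S\<in>UNIV. c S * (\<Sum>i\<in>S. h $ i * (\<Prod>j\<in>S-{i}. x $ j)))) (at x)"
      by (intro has_derivative_sum has_derivative_mult_right has_derivative_prod
          bounded_linear_imp_has_derivative bounded_linear_vec_nth)
    moreover have "h \<bullet> g x = (\<Sum>S\<in>UNIV. c S * (\<Sum>i\<in>S. h $ i * (\<Prod>j\<in>S-{i}. x $ j)))" for h
      unfolding g_def inner_sum_right inner_scaleR_right inner_axis
      by (simp add: mult.commute)
    ultimately show ?thesis
      unfolding gderiv_def q[abs_def] by simp
  qed
  moreover have "continuous_on UNIV g"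
    unfolding g_def by (intro continuous_intros)
  ultimately show ?thesis
    using that by blast
qed

lemma continuous_on_Q1: "q \<in> Q1 \<Longrightarrow> continuous_on S q"
  unfolding Q1_def by (auto intro!: continuous_intros simp: fun_eq_iff[symmetric] cong: continuous_on_cong)

lemma cellwise_Q1_pullback:
  assumes "cellwise_Q1 Th T f" "K \<in> Th" "homeomorphism ref_cell K (T K) G"
  obtains q where "q \<in> Q1" "\<forall>x\<in>interior K. f x = q (G x)"
proof -
  obtain q where q: "q \<in> Q1" "\<forall>\<xi>\<in>interior ref_cell. f (T K \<xi>) = q \<xi>"
    using assms(1,2) unfolding cellwise_Q1_def by blast
  have "f x = q (G x)" if "x \<in> interior K" for x
  proof -
    obtain \<xi> where "\<xi> \<in> interior ref_cell" "x = T K \<xi>"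
      using \<open>x \<in> interior K\<close> homeomorphism_image_interior[OF assms(3)] by blast
    moreover then have "G x = \<xi>"
      using assms(3) interior_subset[of ref_cell] by (auto simp: homeomorphism_def)
    ultimately show ?thesis
      using q(2) by simp
  qed
  with q(1) show ?thesis
    using that by blast
qed

lemma cellwise_Q1_imp_continuous:
  assumes mesh: "regular_mesh \<kappa> D Th T" and f: "cellwise_Q1 Th T f"
  shows "cellwise_continuous Th f"
  unfolding cellwise_continuous_def
proof
  fix K assume K: "K \<in> Th"
  obtain G where h: "homeomorphism ref_cell K (T K) G"
    using mesh_cell[OF mesh K] by (rule cell_map_obtain)
  obtain q where q: "q \<in> Q1" "\<forall>x\<in>interior K. f x = q (G x)"
    using f K h by (rule cellwise_Q1_pullback)
  have "continuous_on K (\<lambda>x. q (G x))"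
    using h by (intro continuous_on_compose2[OF continuous_on_Q1[OF q(1), of UNIV]])
      (auto simp: homeomorphism_def)
  with q(2) show "\<exists>g. continuous_on K g \<and> (\<forall>x\<in>interior K. f x = g x)"
    by blast
qed

lemma GDERIV_of_has_derivative:
  fixes f :: "'a::euclidean_space \<Rightarrow> real"
  assumes "(f has_derivative f') (at x)"
  shows "GDERIV f x :> (\<Sum>b\<in>Basis. f' b *\<^sub>R b)"
proof -
  have lin: "linear f'"
    using assms by (rule has_derivative_linear)
  have "f' h = h \<bullet> (\<Sum>b\<in>Basis. f' b *\<^sub>R b)" for h
  proof -
    have "f' h = f' (\<Sum>b\<in>Basis. (h \<bullet> b) *\<^sub>R b)"
      by (simp add: euclidean_representation)
    also have "\<dots> = (\<Sum>b\<in>Basis. (h \<bullet> b) * f' b)"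
      by (simp add: linear_sum[OF lin] linear_scale[OF lin])
    finally show ?thesis
      by (simp add: inner_sum_right mult.commute)
  qed
  then have "f' = (\<lambda>h. h \<bullet> (\<Sum>b\<in>Basis. f' b *\<^sub>R b))"
    by blast
  then show ?thesis
    using assms unfolding gderiv_def by simp
qed

lemma grad_eqI:
  assumes "GDERIV f x :> g"
  shows "grad f x = g"
  unfolding grad_def
proof (rule the_equality, rule assms)
  fix g' assume "GDERIV f x :> g'"
  then have "(\<lambda>h. h \<bullet> g') = (\<lambda>h. h \<bullet> g)"
    using assms unfolding gderiv_def by (rule has_derivative_unique)
  then show "g' = g"
    by (metis vector_eq_ldot)
qed

text \<open>By the chain rule, the gradient of \<open>q \<circ> G\<close>, with \<open>G\<close> the inverse cell map, is the transposed
  Jacobian of \<open>G\<close> applied to the gradient of \<open>q\<close>.  This expression makes sense on the closed cell,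
  and it is continuous there because \<open>G\<close> is continuously differentiable up to the boundary.\<close>

lemma cellwise_Q1_grad:
  assumes mesh: "regular_mesh \<kappa> D Th T" and f: "cellwise_Q1 Th T f" and K: "K \<in> Th"
  obtains g where "continuous_on K g" "\<forall>x\<in>interior K. GDERIV f x :> g x"
proof -
  obtain G G' where h: "homeomorphism ref_cell K (T K) G" and G': "C1_with K G G'"
    using mesh_cell[OF mesh K] by (auto elim: cell_map_obtain)
  obtain q where q: "q \<in> Q1" "\<forall>x\<in>interior K. f x = q (G x)"
    using f K h by (rule cellwise_Q1_pullback)
  obtain p where p: "\<forall>\<xi>. GDERIV q \<xi> :> p \<xi>" "continuous_on UNIV p"
    using q(1) by (rule Q1_gradient)
  define g where "g = (\<lambda>x. \<Sum>b\<in>Basis. (G' x b \<bullet> p (G x)) *\<^sub>R b)"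
  show ?thesis
  proof
    have "continuous_on K G'" "continuous_on K G"
      using G' h by (auto simp: C1_with_def homeomorphism_def)
    then show "continuous_on K g"
      unfolding g_def
      by (intro continuous_intros continuous_on_compose2[OF p(2)]) auto
  next
    show "\<forall>x\<in>interior K. GDERIV f x :> g x"
    proof
      fix x assume x: "x \<in> interior K"
      have "(G has_derivative G' x) (at x within interior K)"
        using G' x interior_subset[of K] unfolding C1_with_def
        by (meson has_derivative_subset subsetD)
      then have "(G has_derivative G' x) (at x)"
        using at_within_open[OF x open_interior] by simp
      moreover have "(q has_derivative (\<lambda>h. h \<bullet> p (G x))) (at (G x))"
        using p(1) unfolding gderiv_def by (rule spec)
      ultimately have "((\<lambda>x. q (G x)) has_derivative (\<lambda>h. G' x h \<bullet> p (G x))) (at x)"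
        by (rule has_derivative_compose)
      then have "(f has_derivative (\<lambda>h. G' x h \<bullet> p (G x))) (at x)"
        by (rule has_derivative_transform_within_open[OF _ open_interior x]) (simp add: q(2))
      from GDERIV_of_has_derivative[OF this] show "GDERIV f x :> g x"
        by (simp add: g_def)
    qed
  qed
qed

lemma cellwise_Q1_GDERIV:
  assumes "regular_mesh \<kappa> D Th T" "cellwise_Q1 Th T f" "K \<in> Th" "x \<in> interior K"
  shows "GDERIV f x :> grad f x"
proof -
  obtain g where "\<forall>x\<in>interior K. GDERIV f x :> g x"
    using cellwise_Q1_grad[OF assms(1-3)] by blast
  then show ?thesis
    using grad_eqI assms(4) by metis
qed

lemma cellwise_Q1_grad_continuous:
  assumes mesh: "regular_mesh \<kappa> D Th T" and f: "cellwise_Q1 Th T f"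
  shows "cellwise_continuous Th (grad f)"
  unfolding cellwise_continuous_def
proof
  fix K assume K: "K \<in> Th"
  obtain g where "continuous_on K g" "\<forall>x\<in>interior K. GDERIV f x :> g x"
    using mesh f K by (rule cellwise_Q1_grad)
  then show "\<exists>g. continuous_on K g \<and> (\<forall>x\<in>interior K. grad f x = g x)"
    using grad_eqI by blast
qed

lemma cellwise_continuous_vec:
  fixes f :: "real^'d \<Rightarrow> real^'n"
  assumes "\<And>i. cellwise_continuous Th (\<lambda>x. f x $ i)"
  shows "cellwise_continuous Th f"
  unfolding cellwise_continuous_def
proof
  fix K assume "K \<in> Th"
  then have "\<forall>i. \<exists>g. continuous_on K g \<and> (\<forall>x\<in>interior K. f x $ i = g x)"
    using assms unfolding cellwise_continuous_def by blast
  then obtain g where "\<And>i. continuous_on K (g i)" "\<And>i x. x \<in> interior K \<Longrightarrow> f x $ i = g i x"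
    by metis
  then show "\<exists>g. continuous_on K g \<and> (\<forall>x\<in>interior K. f x = g x)"
    by (intro exI[of _ "\<lambda>x. \<chi> i. g i x"]) (auto simp: vec_eq_iff intro!: continuous_on_vec_lambda)
qed

lemma cellwise_continuous_inner:
  fixes f g :: "'a::euclidean_space \<Rightarrow> 'b::real_inner"
  assumes "cellwise_continuous Th f" "cellwise_continuous Th g"
  shows "cellwise_continuous Th (\<lambda>x. f x \<bullet> g x)"
  unfolding cellwise_continuous_def
proof
  fix K assume "K \<in> Th"
  then obtain f0 g0 where "continuous_on K f0" "\<forall>x\<in>interior K. f x = f0 x"
    "continuous_on K g0" "\<forall>x\<in>interior K. g x = g0 x"
    using assms unfolding cellwise_continuous_def by metis
  then show "\<exists>h. continuous_on K h \<and> (\<forall>x\<in>interior K. f x \<bullet> g x = h x)"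
    by (intro exI[of _ "\<lambda>x. f0 x \<bullet> g0 x"]) (auto intro!: continuous_intros)
qed

section \<open>Integration of cellwise continuous functions\<close>

text \<open>On each cell the function is the restriction of a continuous function on a compact set; what is
  left of \<open>D\<close> lies in the null set of cell boundaries.\<close>

lemma cellwise_continuous_absolutely_integrable:
  fixes f :: "real^'d \<Rightarrow> real"
  assumes mesh: "regular_mesh \<kappa> D Th T"
    and D: "open D"
    and f: "cellwise_continuous Th f"
  shows "f absolutely_integrable_on D"
proof -
  have "f absolutely_integrable_on (D \<inter> interior K)" if K: "K \<in> Th" for K
  proof -
    obtain g where g: "continuous_on K g" "\<And>x. x \<in> interior K \<Longrightarrow> f x = g x"
      using f K unfolding cellwise_continuous_def by blast
    have "integrable lborel (\<lambda>x. indicator K x *\<^sub>R g x)"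
      using borel_integrable_compact[OF compact_cell[OF mesh_cell[OF mesh K]] g(1)] .
    then have "g absolutely_integrable_on K"
      unfolding set_integrable_def
      by (subst integrable_completion) auto
    then have "g absolutely_integrable_on (D \<inter> interior K)"
      by (rule set_integrable_subset) (use D interior_subset[of K] in \<open>auto intro!: borel_open\<close>)
    then show ?thesis
      by (rule absolutely_integrable_spike[OF _ negligible_empty]) (simp add: g(2))
  qed
  then have "f absolutely_integrable_on (\<Union>K\<in>Th. D \<inter> interior K)"
    using mesh D by (intro set_integrable_UN) (auto simp: regular_mesh_def)
  moreover have "negligible (D - (\<Union>K\<in>Th. D \<inter> interior K))"
    using negligible_skeleton[OF mesh]
    by (rule negligible_subset) (use skeleton_complement[OF mesh] in blast)
  ultimately have "f absolutely_integrable_on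
      ((\<Union>K\<in>Th. D \<inter> interior K) \<union> (D - (\<Union>K\<in>Th. D \<inter> interior K)))"
    using absolutely_integrable_negligible by (intro absolutely_integrable_Un)
  moreover have "(\<Union>K\<in>Th. D \<inter> interior K) \<union> (D - (\<Union>K\<in>Th. D \<inter> interior K)) = D"
    by blast
  ultimately show ?thesis
    by simp
qed

text \<open>The hypothesis on \<open>u\<close> holds on \<open>D\<close> only, which is enough for gradients since \<open>D\<close> is open.  Off the
  skeleton the gradients exist classically and are linear; the integrability of the products then
  allows the square to be expanded under the integral.\<close>

lemma grad_inner_combination:
  assumes mesh: "regular_mesh \<kappa> D Th T"
    and D: "open D"
    and \<phi>: "cellwise_Q1 Th T \<phi>" and \<psi>: "cellwise_Q1 Th T \<psi>"
    and u: "\<And>x. x \<in> D \<Longrightarrow> u x = a * \<phi> x + b * \<psi> x"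
  shows "grad_inner D u u = a\<^sup>2 * grad_inner D \<phi> \<phi> + 2 * a * b * grad_inner D \<phi> \<psi> + b\<^sup>2 * grad_inner D \<psi> \<psi>"
proof -
  let ?N = "\<Union>K\<in>Th. frontier K"
  have N: "negligible ?N"
    using mesh by (rule negligible_skeleton)
  have gu: "grad u x = a *\<^sub>R grad \<phi> x + b *\<^sub>R grad \<psi> x" if x: "x \<in> D - ?N" for x
  proof -
    obtain K where K: "K \<in> Th" "x \<in> interior K"
      using mesh x by (rule skeleton_complement)
    have "GDERIV \<phi> x :> grad \<phi> x"
      using mesh \<phi> K by (rule cellwise_Q1_GDERIV)
    moreover have "GDERIV \<psi> x :> grad \<psi> x"
      using mesh \<psi> K by (rule cellwise_Q1_GDERIV)
    ultimately have "((\<lambda>x. a * \<phi> x + b * \<psi> x) has_derivative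
        (\<lambda>h. h \<bullet> (a *\<^sub>R grad \<phi> x + b *\<^sub>R grad \<psi> x))) (at x)"
      unfolding gderiv_def by (auto intro!: derivative_eq_intros simp: inner_add_right)
    then have "(u has_derivative (\<lambda>h. h \<bullet> (a *\<^sub>R grad \<phi> x + b *\<^sub>R grad \<psi> x))) (at x)"
      by (rule has_derivative_transform_within_open[OF _ D]) (use x u in auto)
    then show ?thesis
      by (intro grad_eqI) (simp add: gderiv_def)
  qed
  let ?pp = "\<lambda>x. grad \<phi> x \<bullet> grad \<phi> x" and ?pq = "\<lambda>x. grad \<phi> x \<bullet> grad \<psi> x"
    and ?qq = "\<lambda>x. grad \<psi> x \<bullet> grad \<psi> x"
  let ?h = "\<lambda>x. a\<^sup>2 * ?pp x + 2 * a * b * ?pq x + b\<^sup>2 * ?qq x"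
  have int: "?pp absolutely_integrable_on D" "?pq absolutely_integrable_on D"
    "?qq absolutely_integrable_on D"
    by (intro cellwise_continuous_absolutely_integrable[OF mesh D]
        cellwise_continuous_inner cellwise_Q1_grad_continuous[OF mesh] \<phi> \<psi>; assumption)+
  have h: "?h absolutely_integrable_on D"
    by (intro set_integral_add(1) set_integrable_mult_right int)
  have eq: "grad u x \<bullet> grad u x = ?h x" if "x \<in> D - ?N" for x
    using gu[OF that] by (simp add: inner_add_left inner_add_right inner_commute algebra_simps power2_eq_square)
  then have uu: "(\<lambda>x. grad u x \<bullet> grad u x) absolutely_integrable_on D"
    by (rule absolutely_integrable_spike[OF h N])
  have "grad_inner D u u = integral D ?h"
    unfolding grad_inner_def set_lebesgue_integral_eq_integral(2)[OF uu]
    by (rule integral_spike[OF N]) (simp add: eq)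
  also have "\<dots> = (LINT x:D|lebesgue. ?h x)"
    by (rule set_lebesgue_integral_eq_integral(2)[OF h, symmetric])
  also have "\<dots> = a\<^sup>2 * grad_inner D \<phi> \<phi> + 2 * a * b * grad_inner D \<phi> \<psi> + b\<^sup>2 * grad_inner D \<psi> \<psi>"
    unfolding grad_inner_def
    using int by (simp add: set_integral_add set_integrable_mult_right)
  finally show ?thesis .
qed

lemma grad_inner_nonneg: "0 \<le> grad_inner D u u"
  unfolding grad_inner_def set_lebesgue_integral_def by (intro Bochner_Integration.integral_nonneg) auto

section \<open>The nodal basis\<close>

text \<open>The basis polynomial of the corner \<open>c\<close> of the reference cube.\<close>

definition corner_hat :: "real^'d \<Rightarrow> real^'d \<Rightarrow> real" where
  "corner_hat c \<xi> = (\<Prod>i\<in>UNIV. if c $ i = 1 then \<xi> $ i else 1 - \<xi> $ i)"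

text \<open>Each factor is affine in one coordinate, and the product expands over the subsets of coordinates.\<close>

lemma corner_hat_in_Q1: "(\<lambda>\<xi>. corner_hat c \<xi> * a) \<in> Q1"
proof -
  let ?s = "\<lambda>i. if c $ i = 1 then 1 else -1 :: real" and ?t = "\<lambda>i. if c $ i = 1 then 0 else 1 :: real"
  have "corner_hat c \<xi> * a = (\<Sum>S\<in>UNIV. (prod ?s S * prod ?t (UNIV - S) * a) * (\<Prod>i\<in>S. \<xi> $ i))" for \<xi>
  proof -
    have "corner_hat c \<xi> = (\<Prod>i\<in>UNIV. ?s i * \<xi> $ i + ?t i)"
      unfolding corner_hat_def by (rule prod.cong) auto
    also have "\<dots> = (\<Sum>S\<in>UNIV. (\<Prod>i\<in>S. ?s i * \<xi> $ i) * prod ?t (UNIV - S))"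
      by (subst prod_add) auto
    finally show ?thesis
      by (simp only: prod.distrib sum_distrib_right) (simp add: mult_ac)
  qed
  then show ?thesis
    unfolding Q1_def mem_Collect_eq by (intro exI allI)
qed

lemma corner_hat_nonneg: "\<xi> \<in> ref_cell \<Longrightarrow> 0 \<le> corner_hat c \<xi>"
  unfolding corner_hat_def ref_cell_def mem_box_cart by (intro prod_nonneg) auto

lemma corner_hat_corner:
  assumes "\<forall>i. c $ i = 0 \<or> c $ i = 1" "\<forall>i. c' $ i = 0 \<or> c' $ i = 1"
  shows "corner_hat c c' = (if c' = c then 1 else 0)"
proof (cases "c' = c")
  case True
  then show ?thesis
    using assms(1) by (auto simp: corner_hat_def intro!: prod.neutral)
next
  case False
  then obtain i where "c' $ i \<noteq> c $ i"
    by (auto simp: vec_eq_iff)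
  then have "(if c $ i = 1 then c' $ i else 1 - c' $ i) = 0"
    using assms(1)[rule_format, of i] assms(2)[rule_format, of i] by auto
  then have "\<exists>i\<in>UNIV. (if c $ i = 1 then c' $ i else 1 - c' $ i) = 0"
    by (rule bexI[OF _ UNIV_I])
  then have "corner_hat c c' = 0"
    unfolding corner_hat_def by (rule prod_zero[OF finite])
  with False show ?thesis
    by simp
qed

lemma nodal_basis_eq_corner_hat:
  assumes h: "homeomorphism ref_cell K (T K) G" and x: "x \<in> K"
  shows "nodal_basis T K x y = (if y \<in> K then corner_hat (G x) (G y) else 0)"
proof -
  have "inv_into ref_cell (T K) z = G z" if "z \<in> K" for z
  proof (rule inv_into_f_eq)
    show "inj_on (T K) ref_cell"
      by (rule inj_on_inverseI[of _ G]) (rule homeomorphism_apply1[OF h])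
    show "G z \<in> ref_cell" "T K (G z) = z"
      using h that by (auto simp: homeomorphism_def)
  qed
  with x show ?thesis
    by (simp add: nodal_basis_def corner_hat_def Let_def)
qed

text \<open>The nodal basis function of \<open>K\<close> does not vanish on the boundary of \<open>K\<close>; it vanishes in the interior of every
  other cell because an open set that misses the interior of \<open>K\<close> also misses its closure.\<close>

lemma interior_disjoint_other_cell:
  assumes mesh: "regular_mesh \<kappa> D Th T" and "K \<in> Th" "K' \<in> Th" "K' \<noteq> K"
  shows "interior K' \<inter> K = {}"
proof -
  have "interior K' \<inter> interior K = {}"
    using assms by (auto simp: regular_mesh_def pairwise_def)
  then have "interior K' \<inter> closure (interior K) = {}"
    by (simp add: open_Int_closure_eq_empty)
  then show ?thesis
    using cell_subset_closure_interior[OF mesh_cell[OF mesh \<open>K \<in> Th\<close>]] by blast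
qed

lemma continuous_on_corner_hat: "continuous_on S (corner_hat c)"
  using continuous_on_Q1[OF corner_hat_in_Q1[of c 1]] by simp

lemma nodal_basis_tendsto:
  assumes mesh: "regular_mesh \<kappa> D Th T"
    and K: "K \<in> Th" and x: "x \<in> vertices T K" and K': "K' \<in> Th" and x': "x' \<in> vertices T K'"
  shows "(nodal_basis T K x \<longlongrightarrow> (if K' = K \<and> x' = x then 1 else 0)) (at x' within interior K')"
proof (cases "K' = K")
  case False
  have "continuous_on K' (\<lambda>_. 0 :: real)"
    by simp
  moreover have "nodal_basis T K x y = 0" if "y \<in> interior K'" for y
    using interior_disjoint_other_cell[OF mesh K K' False] that by (auto simp: nodal_basis_def)
  ultimately have "(nodal_basis T K x \<longlongrightarrow> 0) (at x' within interior K')"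
    by (rule tendsto_continuous_extension[where T=T, OF mesh_cell[OF mesh K'] x'])
  then show ?thesis
    using False by simp
next
  case True
  note cell = mesh_cell[OF mesh K]
  obtain G where h: "homeomorphism ref_cell K (T K) G"
    using cell by (rule cell_map_obtain)
  have xK: "x \<in> K" and x'K: "x' \<in> vertices T K"
    using vertex_in_cell[OF cell x] x' True by auto
  obtain c c' where c: "\<forall>i. c $ i = 0 \<or> c $ i = 1" "x = T K c"
    and c': "\<forall>i. c' $ i = 0 \<or> c' $ i = 1" "x' = T K c'"
    using x x'K unfolding vertices_def by blast
  have G: "G x = c" "G x' = c'"
    unfolding c(2) c'(2) using homeomorphism_apply1[OF h corner_in_ref_cell] c(1) c'(1) by blast+
  have "continuous_on K (\<lambda>y. corner_hat (G x) (G y))"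
    using homeomorphism_cont2[OF h] by (intro continuous_on_compose2[OF continuous_on_corner_hat[of UNIV]]) auto
  moreover have "nodal_basis T K x y = corner_hat (G x) (G y)" if "y \<in> interior K" for y
    using subsetD[OF interior_subset that] by (simp add: nodal_basis_eq_corner_hat[where T=T, OF h xK])
  ultimately have "(nodal_basis T K x \<longlongrightarrow> corner_hat (G x) (G x')) (at x' within interior K)"
    by (rule tendsto_continuous_extension[where T=T, OF cell x'K])
  moreover have "c' = c \<longleftrightarrow> x' = x"
  proof
    assume "x' = x"
    from arg_cong[where f=G, OF this] show "c' = c"
      by (simp only: G)
  next
    assume "c' = c"
    then show "x' = x"
      by (simp only: c(2) c'(2))
  qed
  ultimately show ?thesis
    using True by (simp add: G corner_hat_corner[OF c(1) c'(1)])
qed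

lemma nodal_basis_in_Vh:
  assumes mesh: "regular_mesh \<kappa> D Th T" and D: "open D"
    and K: "K \<in> Th" and x: "x \<in> vertices T K"
  shows "(\<lambda>y. nodal_basis T K x y * a) \<in> Vh D Th T"
proof -
  note cell = mesh_cell[OF mesh K]
  obtain G where h: "homeomorphism ref_cell K (T K) G"
    using cell by (rule cell_map_obtain)
  have xK: "x \<in> K"
    using vertex_in_cell[OF cell x] .
  let ?p = "\<lambda>y. corner_hat (G x) (G y) * a"
  have z: "nodal_basis T K x y * a = indicator K y *\<^sub>R ?p y" for y
    by (simp add: nodal_basis_eq_corner_hat[where T=T, OF h xK])
  have cont: "continuous_on K ?p"
    using homeomorphism_cont2[OF h]
    by (intro continuous_on_mult_right continuous_on_compose2[OF continuous_on_corner_hat[of UNIV]]) auto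
  have int: "integrable lborel (\<lambda>y. indicator K y *\<^sub>R ?p y)"
    by (rule borel_integrable_compact[OF compact_cell[OF cell] cont])
  have int2: "integrable lborel (\<lambda>y. (nodal_basis T K x y * a)\<^sup>2)"
  proof -
    have "integrable lborel (\<lambda>y. indicator K y *\<^sub>R (?p y)\<^sup>2)"
      by (rule borel_integrable_compact[OF compact_cell[OF cell]]) (intro continuous_intros cont)
    moreover have "indicator K y *\<^sub>R (?p y)\<^sup>2 = (nodal_basis T K x y * a)\<^sup>2" for y
      unfolding z by (simp add: indicator_def)
    ultimately show ?thesis
      by simp
  qed
  have "(\<lambda>y. nodal_basis T K x y * a) \<in> borel_measurable lborel"
    unfolding z by (rule borel_measurable_integrable[OF int])
  then have "(\<lambda>y. nodal_basis T K x y * a) \<in> borel_measurable (lebesgue_on D)"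
    by (intro measurable_restrict_space1 measurable_completion)
  moreover have "integrable lebesgue (\<lambda>y. (nodal_basis T K x y * a)\<^sup>2)"
    using int2 by (subst integrable_completion) auto
  then have "integrable (lebesgue_on D) (\<lambda>y. (nodal_basis T K x y * a)\<^sup>2)"
    using D by (subst integrable_restrict_space)
      (simp, rule integrable_mult_indicator, simp_all)
  ultimately have "(\<lambda>y. nodal_basis T K x y * a) \<in> L2 D"
    by (simp add: L2_def)
  moreover have "\<exists>q\<in>Q1. \<forall>\<xi>\<in>interior ref_cell. nodal_basis T K x (T K' \<xi>) * a = q \<xi>" if K': "K' \<in> Th" for K'
  proof (cases "K' = K")
    case True
    have "nodal_basis T K x (T K' \<xi>) * a = corner_hat (G x) \<xi> * a" if "\<xi> \<in> interior ref_cell" for \<xi>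
    proof -
      have "\<xi> \<in> ref_cell"
        using that interior_subset by blast
      then have "T K \<xi> \<in> K" "G (T K \<xi>) = \<xi>"
        using h by (auto simp: homeomorphism_def)
      then show ?thesis
        using True by (simp add: nodal_basis_eq_corner_hat[where T=T, OF h xK])
    qed
    then show ?thesis
      using corner_hat_in_Q1[of "G x" a] by (intro bexI[of _ "\<lambda>\<xi>. corner_hat (G x) \<xi> * a"]) auto
  next
    case False
    obtain G' where h': "homeomorphism ref_cell K' (T K') G'"
      using mesh_cell[OF mesh K'] by (rule cell_map_obtain)
    have "nodal_basis T K x (T K' \<xi>) * a = corner_hat 0 \<xi> * 0" if "\<xi> \<in> interior ref_cell" for \<xi>
    proof -
      have "T K' \<xi> \<in> interior K'"
        using homeomorphism_image_interior[OF h'] that by blast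
      then have "T K' \<xi> \<notin> K"
        using interior_disjoint_other_cell[OF mesh K K' False] by blast
      then show ?thesis
        by (simp add: nodal_basis_def)
    qed
    then show ?thesis
      using corner_hat_in_Q1[of 0 0] by (intro bexI[of _ "\<lambda>\<xi>. corner_hat 0 \<xi> * 0"]) auto
  qed
  ultimately show ?thesis
    by (simp add: Vh_def cellwise_Q1_def)
qed

lemma lumped_mass_nonneg:
  assumes mesh: "regular_mesh \<kappa> D Th T" and K: "K \<in> Th" and x: "x \<in> vertices T K"
  shows "0 \<le> lumped_mass T K x"
proof -
  note cell = mesh_cell[OF mesh K]
  obtain G where h: "homeomorphism ref_cell K (T K) G"
    using cell by (rule cell_map_obtain)
  have "0 \<le> indicator K y *\<^sub>R nodal_basis T K x y" for y
    using corner_hat_nonneg[of "G y"] homeomorphism_image2[OF h]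
    by (auto simp: nodal_basis_eq_corner_hat[where T=T, OF h vertex_in_cell[OF cell x]] indicator_def)
  then show ?thesis
    unfolding lumped_mass_def set_lebesgue_integral_def
    by (intro Bochner_Integration.integral_nonneg)
qed

section \<open>Sums over all nodes\<close>

definition nodal_sum :: "(real^'d) set set \<Rightarrow> ((real^'d) set \<Rightarrow> real^'d \<Rightarrow> real^'d) \<Rightarrow>
    ((real^'d) set \<Rightarrow> real^'d \<Rightarrow> real) \<Rightarrow> real" where
  "nodal_sum Th T F = (\<Sum>K\<in>Th. \<Sum>x\<in>vertices T K. lumped_mass T K x * F K x)"

lemma nodal_sum_cong:
  assumes "\<And>K x. K \<in> Th \<Longrightarrow> x \<in> vertices T K \<Longrightarrow> lumped_mass T K x = 0 \<or> F K x = G K x"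
  shows "nodal_sum Th T F = nodal_sum Th T G"
  unfolding nodal_sum_def
proof (intro sum.cong refl)
  fix K x assume "K \<in> Th" "x \<in> vertices T K"
  from assms[OF this] show "lumped_mass T K x * F K x = lumped_mass T K x * G K x"
    by auto
qed

lemma nodal_sum_add: "nodal_sum Th T (\<lambda>K x. F K x + G K x) = nodal_sum Th T F + nodal_sum Th T G"
  by (simp add: nodal_sum_def sum.distrib distrib_left)

lemma nodal_sum_mult: "nodal_sum Th T (\<lambda>K x. a * F K x) = a * nodal_sum Th T F"
  by (simp add: nodal_sum_def sum_distrib_left mult_ac)

lemma nodal_sum_nonneg:
  assumes "regular_mesh \<kappa> D Th T" "\<And>K x. K \<in> Th \<Longrightarrow> x \<in> vertices T K \<Longrightarrow> 0 \<le> F K x"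
  shows "0 \<le> nodal_sum Th T F"
  unfolding nodal_sum_def
  by (intro sum_nonneg mult_nonneg_nonneg lumped_mass_nonneg[OF assms(1)] assms(2))

lemma lumped_eq_nodal_sum:
  "lumped Th T f g = nodal_sum Th T (\<lambda>K x. trace_in K f x \<bullet> trace_in K g x)"
  by (simp add: lumped_def nodal_sum_def)

text \<open>Testing with a nodal basis function isolates the contribution of one node.\<close>

lemma lumped_nodal_basis:
  fixes e :: "'b::real_inner"
  assumes mesh: "regular_mesh \<kappa> D Th T" and K: "K \<in> Th" and x: "x \<in> vertices T K"
  shows "lumped Th T f (\<lambda>y. nodal_basis T K x y *\<^sub>R e) = lumped_mass T K x * (trace_in K f x \<bullet> e)"
proof -
  have "trace_in K' (\<lambda>y. nodal_basis T K x y *\<^sub>R e) x' = (if K' = K \<and> x' = x then 1 else 0) *\<^sub>R e"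
    if K': "K' \<in> Th" and x': "x' \<in> vertices T K'" for K' x'
    by (rule trace_in_eqI[where T=T, OF mesh_cell[OF mesh K'] x'])
      (intro tendsto_intros nodal_basis_tendsto[OF mesh K x K' x'])
  then have "lumped Th T f (\<lambda>y. nodal_basis T K x y *\<^sub>R e) =
      (\<Sum>K'\<in>Th. \<Sum>x'\<in>vertices T K'. if K' = K then
         if x' = x then lumped_mass T K x * (trace_in K f x \<bullet> e) else 0 else 0)"
    unfolding lumped_def by (intro sum.cong refl) auto
  also have "\<dots> = (\<Sum>K'\<in>Th. if K' = K then
      \<Sum>x'\<in>vertices T K. if x' = x then lumped_mass T K x * (trace_in K f x \<bullet> e) else 0 else 0)"
    by (intro sum.cong refl) auto
  also have "\<dots> = lumped_mass T K x * (trace_in K f x \<bullet> e)"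
    using mesh K x by (simp add: sum.delta finite_vertices regular_mesh_def)
  finally show ?thesis .
qed

text \<open>The test function is the nodal basis function times the difference of the two traces.  A node
  of zero mass contributes nothing to any lumped quantity, so the disjunction serves as well as
  the equality of traces in nodal sums.\<close>

lemma lumped_eq_imp_trace_eq:
  fixes f g :: "real^'d \<Rightarrow> real^'d"
  assumes mesh: "regular_mesh \<kappa> D Th T" and D: "open D" and K: "K \<in> Th" and x: "x \<in> vertices T K"
    and eq: "\<And>z. z \<in> Vh_vec D Th T \<Longrightarrow> lumped Th T f z = lumped Th T g z"
  shows "lumped_mass T K x = 0 \<or> trace_in K f x = trace_in K g x"
proof -
  let ?e = "trace_in K f x - trace_in K g x"
  have "(\<lambda>y. nodal_basis T K x y *\<^sub>R ?e) \<in> Vh_vec D Th T"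
    using nodal_basis_in_Vh[OF mesh D K x] by (simp add: Vh_vec_def)
  from eq[OF this] have "lumped_mass T K x * (?e \<bullet> ?e) = 0"
    by (simp only: lumped_nodal_basis[OF mesh K x]) (simp add: inner_diff_left right_diff_distrib)
  then show ?thesis
    by simp
qed

section \<open>Inverting the rotation\<close>

text \<open>Orthogonality of \<open>v \<times> w\<close> to \<open>v\<close> gives \<open>(v - c (v \<times> w)) \<bullet> v = |v|\<^sup>2\<close>.  Hence \<open>v \<mapsto> v - c (v \<times> w)\<close> does
  not decrease norms, which yields its invertibility for every real \<open>c\<close> and a bound \<open>1\<close> on the
  inverse, uniformly in \<open>w\<close>.\<close>

locale skew_product = bounded_bilinear crs
  for crs :: "real^'d \<Rightarrow> 'w::real_normed_vector \<Rightarrow> real^'d" +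
  assumes crs_orthogonal: "crs v w \<bullet> v = 0"
begin

definition resolvent :: "real \<Rightarrow> 'w \<Rightarrow> real^'d \<Rightarrow> real^'d" where
  "resolvent c w = inv (\<lambda>v. v - c *\<^sub>R crs v w)"

lemma norm_le_norm_minus_crs: "norm v \<le> norm (v - c *\<^sub>R crs v w)"
proof -
  have "norm v * norm v = (v - c *\<^sub>R crs v w) \<bullet> v"
    by (simp add: inner_diff_left crs_orthogonal norm_eq_sqrt_inner)
  also have "\<dots> \<le> norm (v - c *\<^sub>R crs v w) * norm v"
    by (rule norm_cauchy_schwarz)
  finally show ?thesis
    by (cases "v = 0") auto
qed

lemma linear_minus_crs: "linear (\<lambda>v. v - c *\<^sub>R crs v w)"
  by (rule linearI) (simp_all add: add_left scaleR_left algebra_simps)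

lemma inj_minus_crs: "inj (\<lambda>v. v - c *\<^sub>R crs v w)"
proof -
  have "v = 0" if "v - c *\<^sub>R crs v w = 0" for v
    using norm_le_norm_minus_crs[of v c w] that by simp
  then show ?thesis
    unfolding linear_injective_0[OF linear_minus_crs] by blast
qed

lemma resolvent_minus_crs: "resolvent c w v - c *\<^sub>R crs (resolvent c w v) w = v"
proof -
  have "surj (\<lambda>v. v - c *\<^sub>R crs v w)"
    using linear_minus_crs[of c w] inj_minus_crs[of c w] by (rule linear_inj_imp_surj)
  from surj_f_inv_f[OF this, of v] show ?thesis
    unfolding resolvent_def .
qed

lemma resolvent_eqI: "u - c *\<^sub>R crs u w = v \<Longrightarrow> resolvent c w v = u"
  unfolding resolvent_def using inj_minus_crs[of c w] by (rule inv_f_eq)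

lemma linear_resolvent: "linear (resolvent c w)"
proof (rule linearI)
  fix u v :: "real^'d" and a :: real
  have "(resolvent c w u + resolvent c w v) - c *\<^sub>R crs (resolvent c w u + resolvent c w v) w =
      (resolvent c w u - c *\<^sub>R crs (resolvent c w u) w) + (resolvent c w v - c *\<^sub>R crs (resolvent c w v) w)"
    by (simp add: add_left algebra_simps)
  then show "resolvent c w (u + v) = resolvent c w u + resolvent c w v"
    by (intro resolvent_eqI) (simp only: resolvent_minus_crs)
  have "a *\<^sub>R resolvent c w u - c *\<^sub>R crs (a *\<^sub>R resolvent c w u) w =
      a *\<^sub>R (resolvent c w u - c *\<^sub>R crs (resolvent c w u) w)"
    by (simp add: scaleR_left algebra_simps)
  then show "resolvent c w (a *\<^sub>R u) = a *\<^sub>R resolvent c w u"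
    by (intro resolvent_eqI) (simp only: resolvent_minus_crs)
qed

lemma Binv_eq_resolvent: "Binv crs \<Omega> \<tau> \<theta> f x = resolvent (\<theta> * \<tau>) (\<Omega> x) (f x)"
  unfolding Binv_def resolvent_def Bmap_def ..

text \<open>Let \<open>u\<close> be the resolvent at \<open>w x\<close> of \<open>f x\<close> and \<open>r\<close> the claimed limit.  By the norm bound,
  \<open>|u - r|\<close> is at most the norm of the image of \<open>u - r\<close> under the rotation with parameter \<open>w x\<close>, that is, of
  \<open>f x - (r - c (r \<times> w x))\<close>, and this residual tends to \<open>0\<close>.\<close>

lemma tendsto_resolvent:
  assumes w: "(w \<longlongrightarrow> w0) F" and f: "(f \<longlongrightarrow> l) F"
  shows "((\<lambda>x. resolvent c (w x) (f x)) \<longlongrightarrow> resolvent c w0 l) F"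
proof -
  let ?r = "resolvent c w0 l"
  have "((\<lambda>x. f x - (?r - c *\<^sub>R crs ?r (w x))) \<longlongrightarrow> l - (?r - c *\<^sub>R crs ?r w0)) F"
    by (intro tendsto_intros f tendsto[OF _ w])
  then have "((\<lambda>x. norm (f x - (?r - c *\<^sub>R crs ?r (w x)))) \<longlongrightarrow> 0) F"
    by (simp add: resolvent_minus_crs tendsto_norm_zero_iff)
  moreover
  have "norm (resolvent c (w x) (f x) - ?r) \<le> norm (f x - (?r - c *\<^sub>R crs ?r (w x)))" for x
  proof -
    let ?v = "resolvent c (w x) (f x)"
    have "norm (?v - ?r) \<le> norm ((?v - ?r) - c *\<^sub>R crs (?v - ?r) (w x))"
      by (rule norm_le_norm_minus_crs)
    also have "(?v - ?r) - c *\<^sub>R crs (?v - ?r) (w x) =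
        (?v - c *\<^sub>R crs ?v (w x)) - (?r - c *\<^sub>R crs ?r (w x))"
      by (simp add: diff_left algebra_simps)
    finally show ?thesis
      by (simp only: resolvent_minus_crs)
  qed
  then have "eventually (\<lambda>x. norm (resolvent c (w x) (f x) - ?r) \<le>
      norm (f x - (?r - c *\<^sub>R crs ?r (w x)))) F"
    by (intro always_eventually allI)
  ultimately have "((\<lambda>x. resolvent c (w x) (f x) - ?r) \<longlongrightarrow> 0) F"
    by (rule Lim_null_comparison[rotated])
  then show ?thesis
    by (rule LIM_zero_cancel)
qed

lemma trace_in_Binv:
  assumes mesh: "regular_mesh \<kappa> D Th T" and K: "K \<in> Th" and x: "x \<in> vertices T K"
    and \<Omega>: "cellwise_continuous Th \<Omega>" and f: "cellwise_continuous Th f"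
    and \<rho>: "cellwise_continuous Th \<rho>"
  shows "trace_in K (\<lambda>x. \<rho> x *\<^sub>R Binv crs \<Omega> \<tau> \<theta> f x) x =
    trace_in K \<rho> x *\<^sub>R resolvent (\<theta> * \<tau>) (trace_in K \<Omega> x) (trace_in K f x)"
proof -
  note lim = cellwise_continuous_tendsto[OF _ K mesh_cell[OF mesh K] x]
  show ?thesis
    unfolding Binv_eq_resolvent
    by (rule trace_in_eqI[where T=T, OF mesh_cell[OF mesh K] x])
      (rule tendsto_scaleR[OF lim[OF \<rho>] tendsto_resolvent[OF lim[OF \<Omega>] lim[OF f]]])
qed

section \<open>Energy balance\<close>

text \<open>The first term on the right is the work of the field, the second the dissipation of the
  \<open>\<theta>\<close>-scheme; the rotation disappears because it is orthogonal to \<open>v\<theta>\<close>.\<close>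

lemma kinetic_energy_increment:
  assumes \<theta>: "\<theta> > 0" and v\<theta>: "v\<theta> = resolvent (\<theta> * \<tau>) w (v - (\<theta> * \<tau>) *\<^sub>R g)"
    and v': "\<theta> *\<^sub>R v' = v\<theta> - (1 - \<theta>) *\<^sub>R v"
  shows "1/2 * ((norm v')\<^sup>2 - (norm v)\<^sup>2) =
    - \<tau> * (v\<theta> \<bullet> g) - (2 * \<theta> - 1) / (2 * \<theta>\<^sup>2) * (norm (v\<theta> - v))\<^sup>2"
proof -
  (* the power at the intermediate level: the rotation does no work *)
  have "v\<theta> - (\<theta> * \<tau>) *\<^sub>R crs v\<theta> w = v - (\<theta> * \<tau>) *\<^sub>R g"
    unfolding v\<theta> by (rule resolvent_minus_crs)
  then have "v\<theta> - v = (\<theta> * \<tau>) *\<^sub>R crs v\<theta> w - (\<theta> * \<tau>) *\<^sub>R g"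
    by (simp add: algebra_simps)
  then have "(v\<theta> - v) \<bullet> v\<theta> = ((\<theta> * \<tau>) *\<^sub>R crs v\<theta> w - (\<theta> * \<tau>) *\<^sub>R g) \<bullet> v\<theta>"
    by simp
  then have power: "(v\<theta> - v) \<bullet> v\<theta> = - \<theta> * \<tau> * (v\<theta> \<bullet> g)"
    by (simp add: inner_diff_left crs_orthogonal) (simp add: inner_commute)
  have "\<theta>\<^sup>2 * (norm v')\<^sup>2 = (norm (\<theta> *\<^sub>R v'))\<^sup>2"
    by (simp add: power_mult_distrib)
  also have "\<dots> = \<theta>\<^sup>2 * (norm v)\<^sup>2 + 2 * \<theta> * ((v\<theta> - v) \<bullet> v\<theta>) - (2 * \<theta> - 1) * (norm (v\<theta> - v))\<^sup>2"
    unfolding v' power2_norm_eq_inner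
    by (simp add: inner_diff_left inner_diff_right inner_commute[of v v\<theta>])
      (simp add: algebra_simps power2_eq_square)
  finally have "\<theta>\<^sup>2 * ((norm v')\<^sup>2 - (norm v)\<^sup>2) =
      - 2 * \<theta>\<^sup>2 * \<tau> * (v\<theta> \<bullet> g) - (2 * \<theta> - 1) * (norm (v\<theta> - v))\<^sup>2"
    unfolding power by (simp add: power2_eq_square algebra_simps)
  then show ?thesis
    using \<theta> by (simp add: field_simps)
qed

end

lemma cellwise_Q1_Hh0: "\<phi> \<in> Hh0 D Th T \<Longrightarrow> cellwise_Q1 Th T \<phi>"
  by (simp add: Hh0_def Hh_def)

lemma Vh_imp_continuous: "regular_mesh \<kappa> D Th T \<Longrightarrow> z \<in> Vh D Th T \<Longrightarrow> cellwise_continuous Th z"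
  by (auto simp: Vh_def intro: cellwise_Q1_imp_continuous)

lemma Vh_vec_imp_continuous:
  "regular_mesh \<kappa> D Th T \<Longrightarrow> z \<in> Vh_vec D Th T \<Longrightarrow> cellwise_continuous Th z"
  by (rule cellwise_continuous_vec) (auto simp: Vh_vec_def intro: Vh_imp_continuous)

context skew_product
begin

text \<open>The number \<open>r\<close> is the sum of the lumped \<open>\<rho> |v\<^sub>\<theta> - v|\<^sup>2\<close> and of \<open>1/\<alpha>\<close> times the integral of
  \<open>|\<nabla>\<phi>\<^sub>\<theta> - \<nabla>\<phi>|\<^sup>2\<close>.  All dependence on the sign of \<open>2 \<theta> - 1\<close> is in the factor in front of it.\<close>

lemma source_update_energy_balance:
  assumes \<alpha>: "\<alpha> > 0" and \<theta>: "\<theta> > 0"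
    and D: "open D" and mesh: "regular_mesh \<kappa> D Th T" and \<Omega>: "cellwise_continuous Th \<Omega>"
    and \<rho>: "\<rho> \<in> Vh D Th T" and pos: "\<And>K x. K \<in> Th \<Longrightarrow> x \<in> vertices T K \<Longrightarrow> trace_in K \<rho> x > 0"
    and \<phi>: "\<phi> \<in> Hh0 D Th T"
    and upd: "source_update D Th T crs \<Omega> \<alpha> \<tau> \<theta> \<rho> m E \<phi> \<rho>' m' E' \<phi>'"
  obtains r where "r \<ge> 0"
    "total_energy D Th T \<alpha> E' \<phi>' = total_energy D Th T \<alpha> E \<phi> - (2 * \<theta> - 1) / (2 * \<theta>\<^sup>2) * r"
proof -
  obtain v \<epsilon> \<phi>\<theta> v\<theta> v' where
    mem: "v \<in> Vh_vec D Th T" "\<phi>\<theta> \<in> Hh0 D Th T" "v\<theta> \<in> Vh_vec D Th T"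
    and old': "\<forall>K\<in>Th. \<forall>x\<in>vertices T K.
        trace_in K v x = trace_in K m x /\<^sub>R trace_in K \<rho> x \<and>
        trace_in K \<epsilon> x = trace_in K E x - 1/2 * (norm (trace_in K m x))\<^sup>2 / trace_in K \<rho> x"
    and schur': "\<forall>\<psi>\<in>Hh0 D Th T.
        a_form D Th T crs \<Omega> \<alpha> \<tau> \<theta> \<rho> \<phi>\<theta> \<psi> = grad_inner D \<phi> \<psi> +
          \<theta> * \<tau> * \<alpha> * lumped Th T (\<lambda>x. \<rho> x *\<^sub>R Binv crs \<Omega> \<tau> \<theta> v x) (grad \<psi>)"
    and velocity': "\<forall>z\<in>Vh_vec D Th T. lumped Th T v\<theta> z =
        lumped Th T (Binv crs \<Omega> \<tau> \<theta> (\<lambda>x. v x - (\<theta> * \<tau>) *\<^sub>R grad \<phi>\<theta> x)) z"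
    and v': "cellwise_eq Th (\<lambda>x. \<theta> *\<^sub>R v' x) (\<lambda>x. v\<theta> x - (1 - \<theta>) *\<^sub>R v x)"
    and \<phi>'': "\<forall>x\<in>D. \<theta> * \<phi>' x = \<phi>\<theta> x - (1 - \<theta>) * \<phi> x"
    and new': "\<forall>K\<in>Th. \<forall>x\<in>vertices T K.
        trace_in K m' x = trace_in K \<rho> x *\<^sub>R trace_in K v' x \<and>
        trace_in K E' x = trace_in K \<epsilon> x + 1/2 * trace_in K \<rho> x * (norm (trace_in K v' x))\<^sup>2"
    using upd unfolding source_update_def by (elim bexE conjE) (rule that)
  note old = old'[rule_format] and schur = schur'[rule_format] and velocity = velocity'[rule_format]
    and \<phi>' = \<phi>''[rule_format] and new = new'[rule_format]

  note cont_\<rho> = Vh_imp_continuous[OF mesh \<rho>]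
    and cont_v = Vh_vec_imp_continuous[OF mesh mem(1)]
    and cont_v\<theta> = Vh_vec_imp_continuous[OF mesh mem(3)]
    and cont_g = cellwise_Q1_grad_continuous[OF mesh cellwise_Q1_Hh0[OF mem(2)]]

  (* values at the node x of K; R is the inverse rotation there *)
  define nv where "nv K x = trace_in K v x" for K x
  define nv\<theta> where "nv\<theta> K x = trace_in K v\<theta> x" for K x
  define ng where "ng K x = trace_in K (grad \<phi>\<theta>) x" for K x
  define n\<rho> where "n\<rho> K x = trace_in K \<rho> x" for K x
  define R where "R K x = resolvent (\<theta> * \<tau>) (trace_in K \<Omega> x)" for K x

  have velocity_node: "lumped_mass T K x = 0 \<or> nv\<theta> K x = R K x (nv K x - (\<theta> * \<tau>) *\<^sub>R ng K x)"
    if K: "K \<in> Th" and x: "x \<in> vertices T K" for K x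
  proof -
    note lim = cellwise_continuous_tendsto[OF _ K mesh_cell[OF mesh K] x]
    have "trace_in K (Binv crs \<Omega> \<tau> \<theta> (\<lambda>x. v x - (\<theta> * \<tau>) *\<^sub>R grad \<phi>\<theta> x)) x =
        R K x (nv K x - (\<theta> * \<tau>) *\<^sub>R ng K x)"
      unfolding R_def nv_def ng_def Binv_eq_resolvent[abs_def]
      by (rule trace_in_eqI[where T=T, OF mesh_cell[OF mesh K] x])
        (rule tendsto_resolvent[OF lim[OF \<Omega>]
            tendsto_diff[OF lim[OF cont_v] tendsto_scaleR[OF tendsto_const lim[OF cont_g]]]])
    then show ?thesis
      using lumped_eq_imp_trace_eq[OF mesh D K x velocity] by (simp add: nv\<theta>_def)
  qed

  have v'_node: "\<theta> *\<^sub>R trace_in K v' x = nv\<theta> K x - (1 - \<theta>) *\<^sub>R nv K x"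
    if K: "K \<in> Th" and x: "x \<in> vertices T K" for K x
  proof -
    note lim = cellwise_continuous_tendsto[OF _ K mesh_cell[OF mesh K] x]
    have "trace_in K v' x = trace_in K (\<lambda>y. (v\<theta> y - (1 - \<theta>) *\<^sub>R v y) /\<^sub>R \<theta>) x"
    proof (rule trace_in_cong)
      fix y assume "y \<in> interior K"
      then have "\<theta> *\<^sub>R v' y = v\<theta> y - (1 - \<theta>) *\<^sub>R v y"
        using v' K by (simp add: cellwise_eq_def)
      then have "(\<theta> *\<^sub>R v' y) /\<^sub>R \<theta> = (v\<theta> y - (1 - \<theta>) *\<^sub>R v y) /\<^sub>R \<theta>"
        by simp
      then show "v' y = (v\<theta> y - (1 - \<theta>) *\<^sub>R v y) /\<^sub>R \<theta>"
        using \<theta> by simp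
    qed
    also have "\<dots> = (nv\<theta> K x - (1 - \<theta>) *\<^sub>R nv K x) /\<^sub>R \<theta>"
      unfolding nv_def nv\<theta>_def
      by (rule trace_in_eqI[where T=T, OF mesh_cell[OF mesh K] x])
        (rule tendsto_scaleR[OF tendsto_const
            tendsto_diff[OF lim[OF cont_v\<theta>] tendsto_scaleR[OF tendsto_const lim[OF cont_v]]]])
    finally show ?thesis
      using \<theta> by simp
  qed

  (* ?P is the power exchanged between fluid and field; it enters the two energies with opposite
     signs. *)
  let ?P = "nodal_sum Th T (\<lambda>K x. n\<rho> K x * (nv\<theta> K x \<bullet> ng K x))"
  let ?Q = "nodal_sum Th T (\<lambda>K x. n\<rho> K x * (norm (nv\<theta> K x - nv K x))\<^sup>2)"
  let ?c = "(2 * \<theta> - 1) / (2 * \<theta>\<^sup>2)"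

  have nodal_energy: "nodal_sum Th T (\<lambda>K x. trace_in K E' x) =
      nodal_sum Th T (\<lambda>K x. trace_in K E x) - \<tau> * ?P - ?c * ?Q"
  proof -
    have "nodal_sum Th T (\<lambda>K x. trace_in K E' x) = nodal_sum Th T (\<lambda>K x. trace_in K E x +
        ((- \<tau>) * (n\<rho> K x * (nv\<theta> K x \<bullet> ng K x)) + (- ?c) * (n\<rho> K x * (norm (nv\<theta> K x - nv K x))\<^sup>2)))"
    proof (rule nodal_sum_cong)
      fix K x assume K: "K \<in> Th" and x: "x \<in> vertices T K"
      have "n\<rho> K x > 0"
        using pos[OF K x] by (simp add: n\<rho>_def)
      then have "(norm (trace_in K m x))\<^sup>2 / n\<rho> K x = n\<rho> K x * (norm (nv K x))\<^sup>2"
        using old[OF K x] by (simp add: nv_def n\<rho>_def power_mult_distrib power2_eq_square field_simps)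
      then have "trace_in K E' x = trace_in K E x +
          n\<rho> K x * (1/2 * ((norm (trace_in K v' x))\<^sup>2 - (norm (nv K x))\<^sup>2))"
        using old[OF K x] new[OF K x] by (simp add: n\<rho>_def algebra_simps)
      moreover have "1/2 * ((norm (trace_in K v' x))\<^sup>2 - (norm (nv K x))\<^sup>2) =
          - \<tau> * (nv\<theta> K x \<bullet> ng K x) - ?c * (norm (nv\<theta> K x - nv K x))\<^sup>2"
        if "lumped_mass T K x \<noteq> 0"
        using velocity_node[OF K x] v'_node[OF K x] that
        unfolding R_def by (intro kinetic_energy_increment[OF \<theta>]) auto
      moreover have "n * (- t * p - c * q) = (- t) * (n * p) + (- c) * (n * q)" for n t p c q :: real
        by (simp add: algebra_simps)
      ultimately show "lumped_mass T K x = 0 \<or> trace_in K E' x = trace_in K E x +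
          ((- \<tau>) * (n\<rho> K x * (nv\<theta> K x \<bullet> ng K x)) + (- ?c) * (n\<rho> K x * (norm (nv\<theta> K x - nv K x))\<^sup>2))"
        by (metis (no_types, lifting))
    qed
    then show ?thesis
      by (simp only: nodal_sum_add nodal_sum_mult)
  qed

  (* The potential equation tested with \<phi>\<theta>.  The term with \<theta>\<^sup>2 \<tau>\<^sup>2 \<alpha> moves to the right and completes
     the inverse rotation of v to that of v - \<theta> \<tau> \<nabla>\<phi>\<theta>, which is v\<theta>. *)
  have potential: "grad_inner D \<phi>\<theta> \<phi>\<theta> - grad_inner D \<phi> \<phi>\<theta> = \<theta> * \<tau> * \<alpha> * ?P"
  proof -
    let ?Sg = "nodal_sum Th T (\<lambda>K x. n\<rho> K x * (R K x (ng K x) \<bullet> ng K x))"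
    let ?Sv = "nodal_sum Th T (\<lambda>K x. n\<rho> K x * (R K x (nv K x) \<bullet> ng K x))"
    have "lumped Th T (\<lambda>x. \<rho> x *\<^sub>R Binv crs \<Omega> \<tau> \<theta> (grad \<phi>\<theta>) x) (grad \<phi>\<theta>) = ?Sg"
      "lumped Th T (\<lambda>x. \<rho> x *\<^sub>R Binv crs \<Omega> \<tau> \<theta> v x) (grad \<phi>\<theta>) = ?Sv"
      unfolding lumped_eq_nodal_sum
      by (rule nodal_sum_cong,
          simp add: trace_in_Binv[OF mesh _ _ \<Omega> _ cont_\<rho>] cont_v cont_g n\<rho>_def nv_def ng_def R_def)+
    then have "grad_inner D \<phi>\<theta> \<phi>\<theta> + \<theta>\<^sup>2 * \<tau>\<^sup>2 * \<alpha> * ?Sg = grad_inner D \<phi> \<phi>\<theta> + \<theta> * \<tau> * \<alpha> * ?Sv"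
      using schur[OF mem(2)] by (simp add: a_form_def)
    then have "grad_inner D \<phi>\<theta> \<phi>\<theta> - grad_inner D \<phi> \<phi>\<theta> = \<theta> * \<tau> * \<alpha> * (?Sv + (- (\<theta> * \<tau>)) * ?Sg)"
      by (simp add: algebra_simps power2_eq_square)
    moreover have "?P = ?Sv + (- (\<theta> * \<tau>)) * ?Sg"
    proof -
      have "?P = nodal_sum Th T (\<lambda>K x. n\<rho> K x * (R K x (nv K x) \<bullet> ng K x) +
          (- (\<theta> * \<tau>)) * (n\<rho> K x * (R K x (ng K x) \<bullet> ng K x)))"
      proof (rule nodal_sum_cong)
        fix K x assume K: "K \<in> Th" and x: "x \<in> vertices T K"
        have "R K x (nv K x - (\<theta> * \<tau>) *\<^sub>R ng K x) = R K x (nv K x) - (\<theta> * \<tau>) *\<^sub>R R K x (ng K x)"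
          unfolding R_def using linear_resolvent by (simp add: linear_diff linear_scale)
        then have "lumped_mass T K x = 0 \<or> nv\<theta> K x = R K x (nv K x) - (\<theta> * \<tau>) *\<^sub>R R K x (ng K x)"
          using velocity_node[OF K x] by (simp only:)
        then show "lumped_mass T K x = 0 \<or> n\<rho> K x * (nv\<theta> K x \<bullet> ng K x) =
            n\<rho> K x * (R K x (nv K x) \<bullet> ng K x) + (- (\<theta> * \<tau>)) * (n\<rho> K x * (R K x (ng K x) \<bullet> ng K x))"
        proof (elim disj_forward)
          assume "nv\<theta> K x = R K x (nv K x) - (\<theta> * \<tau>) *\<^sub>R R K x (ng K x)"
          then show "n\<rho> K x * (nv\<theta> K x \<bullet> ng K x) =
            n\<rho> K x * (R K x (nv K x) \<bullet> ng K x) + (- (\<theta> * \<tau>)) * (n\<rho> K x * (R K x (ng K x) \<bullet> ng K x))"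
            by (simp only: inner_diff_left inner_scaleR_left) (simp add: algebra_simps)
        qed
      qed
      then show ?thesis
        by (simp only: nodal_sum_add nodal_sum_mult)
    qed
    ultimately show ?thesis
      by (simp only:)
  qed

  let ?A = "grad_inner D \<phi>\<theta> \<phi>\<theta>" and ?B = "grad_inner D \<phi> \<phi>\<theta>" and ?C = "grad_inner D \<phi> \<phi>"
  note comb = grad_inner_combination[OF mesh D cellwise_Q1_Hh0[OF \<phi>] cellwise_Q1_Hh0[OF mem(2)]]
  have "grad_inner D (\<lambda>x. \<phi>\<theta> x - \<phi> x) (\<lambda>x. \<phi>\<theta> x - \<phi> x) = ?A - 2 * ?B + ?C"
    by (subst comb[of _ "-1" 1]) auto
  then have G: "0 \<le> ?A - 2 * ?B + ?C"
    using grad_inner_nonneg by metis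
  have "grad_inner D \<phi>' \<phi>' =
      (- (1 - \<theta>) / \<theta>)\<^sup>2 * ?C + 2 * (- (1 - \<theta>) / \<theta>) * (1 / \<theta>) * ?B + (1 / \<theta>)\<^sup>2 * ?A"
  proof (rule comb)
    fix x assume "x \<in> D"
    from \<phi>'[OF this] show "\<phi>' x = - (1 - \<theta>) / \<theta> * \<phi> x + 1 / \<theta> * \<phi>\<theta> x"
      using \<theta> by (simp add: field_simps)
  qed
  then have "\<theta>\<^sup>2 * grad_inner D \<phi>' \<phi>' = \<theta>\<^sup>2 * ((- (1 - \<theta>) / \<theta>)\<^sup>2 * ?C + 2 * (- (1 - \<theta>) / \<theta>) * (1 / \<theta>) * ?B + (1 / \<theta>)\<^sup>2 * ?A)"
    by simp
  also have "\<dots> = \<theta>\<^sup>2 * ?C + 2 * \<theta> * (?A - ?B) - (2 * \<theta> - 1) * (?A - 2 * ?B + ?C)"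
    using \<theta> by (simp add: field_simps power2_eq_square)
  finally have "grad_inner D \<phi>' \<phi>' = ?C + 2 * \<tau> * \<alpha> * ?P - (2 * \<theta> - 1) / \<theta>\<^sup>2 * (?A - 2 * ?B + ?C)"
    unfolding potential using \<theta> by (simp add: field_simps power2_eq_square)
  moreover have "1 / (2 * \<alpha>) * (c + 2 * \<tau> * \<alpha> * p - (2 * \<theta> - 1) / \<theta>\<^sup>2 * q) =
      1 / (2 * \<alpha>) * c + \<tau> * p - ?c * (q / \<alpha>)" for c p q
    using \<alpha> \<theta> by (simp add: field_simps)
  ultimately have field_energy: "1 / (2 * \<alpha>) * grad_inner D \<phi>' \<phi>' =
      1 / (2 * \<alpha>) * ?C + \<tau> * ?P - ?c * ((?A - 2 * ?B + ?C) / \<alpha>)"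
    by (simp only:)

  have total: "total_energy D Th T \<alpha> F \<psi> =
      nodal_sum Th T (\<lambda>K x. trace_in K F x) + 1 / (2 * \<alpha>) * grad_inner D \<psi> \<psi>" for F \<psi>
    by (simp add: total_energy_def nodal_sum_def grad_inner_def power2_norm_eq_inner)
  show ?thesis
  proof
    have "0 \<le> ?Q"
      by (rule nodal_sum_nonneg[OF mesh]) (simp add: n\<rho>_def pos less_imp_le)
    then show "0 \<le> ?Q + (?A - 2 * ?B + ?C) / \<alpha>"
      using G \<alpha> by simp
    show "total_energy D Th T \<alpha> E' \<phi>' = total_energy D Th T \<alpha> E \<phi> - ?c * (?Q + (?A - 2 * ?B + ?C) / \<alpha>)"
      unfolding total nodal_energy field_energy by (simp add: algebra_simps)
  qed
qed

text \<open>The total energy is rebuilt from the old internal energy and the new kinetic energy, which is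
  \<open>|m'|\<^sup>2 / (2 \<rho>)\<close> because \<open>m' = \<rho> v'\<close>.\<close>

lemma source_update_internal_energy:
  assumes pos: "trace_in K \<rho> x > 0" and K: "K \<in> Th" and x: "x \<in> vertices T K"
    and upd: "source_update D Th T crs \<Omega> \<alpha> \<tau> \<theta> \<rho> m E \<phi> \<rho>' m' E' \<phi>'"
  shows "trace_in K \<rho>' x = trace_in K \<rho> x \<and>
    trace_in K E' x - 1/2 * (norm (trace_in K m' x))\<^sup>2 / trace_in K \<rho>' x =
    trace_in K E x - 1/2 * (norm (trace_in K m x))\<^sup>2 / trace_in K \<rho> x"
proof -
  obtain \<epsilon> v' where
    \<epsilon>: "trace_in K \<epsilon> x = trace_in K E x - 1/2 * (norm (trace_in K m x))\<^sup>2 / trace_in K \<rho> x"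
    and m': "trace_in K m' x = trace_in K \<rho> x *\<^sub>R trace_in K v' x"
    and E': "trace_in K E' x = trace_in K \<epsilon> x + 1/2 * trace_in K \<rho> x * (norm (trace_in K v' x))\<^sup>2"
    and eq: "cellwise_eq Th \<rho>' \<rho>"
    using upd K x unfolding source_update_def by blast
  have "trace_in K \<rho>' x = trace_in K \<rho> x"
    using eq K by (intro trace_in_cong) (simp add: cellwise_eq_def)
  moreover have "(norm (trace_in K m' x))\<^sup>2 / trace_in K \<rho> x = trace_in K \<rho> x * (norm (trace_in K v' x))\<^sup>2"
    unfolding m' using pos by (simp add: power_mult_distrib power2_eq_square)
  ultimately show ?thesis
    using E' \<epsilon> by simp
qed

lemma source_update_stable:
  assumes \<alpha>: "\<alpha> > 0" and \<theta>: "1/2 \<le> \<theta>"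
    and D: "open D" and mesh: "regular_mesh \<kappa> D Th T" and \<Omega>: "cellwise_continuous Th \<Omega>"
    and \<rho>: "\<rho> \<in> Vh D Th T" and pos: "\<forall>K\<in>Th. \<forall>x\<in>vertices T K. trace_in K \<rho> x > 0"
    and \<phi>: "\<phi> \<in> Hh0 D Th T"
    and upd: "source_update D Th T crs \<Omega> \<alpha> \<tau> \<theta> \<rho> m E \<phi> \<rho>' m' E' \<phi>'"
  shows "total_energy D Th T \<alpha> E' \<phi>' \<le> total_energy D Th T \<alpha> E \<phi> \<and>
    (\<theta> = 1/2 \<longrightarrow> total_energy D Th T \<alpha> E' \<phi>' = total_energy D Th T \<alpha> E \<phi>) \<and>
    (\<forall>K\<in>Th. \<forall>x\<in>vertices T K.
       trace_in K \<rho>' x = trace_in K \<rho> x \<and>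
       trace_in K E' x - 1/2 * (norm (trace_in K m' x))\<^sup>2 / trace_in K \<rho>' x =
       trace_in K E x - 1/2 * (norm (trace_in K m x))\<^sup>2 / trace_in K \<rho> x)"
proof -
  have "\<theta> > 0"
    using \<theta> by simp
  then obtain r where r: "r \<ge> 0"
    "total_energy D Th T \<alpha> E' \<phi>' = total_energy D Th T \<alpha> E \<phi> - (2 * \<theta> - 1) / (2 * \<theta>\<^sup>2) * r"
    using source_update_energy_balance[OF \<alpha> _ D mesh \<Omega> \<rho> pos[rule_format] \<phi> upd] by blast
  have "0 \<le> (2 * \<theta> - 1) / (2 * \<theta>\<^sup>2) * r"
    using \<theta> r(1) by (intro mult_nonneg_nonneg divide_nonneg_nonneg) auto
  then have "total_energy D Th T \<alpha> E' \<phi>' \<le> total_energy D Th T \<alpha> E \<phi>"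
    using r(2) by simp
  moreover have "\<theta> = 1/2 \<longrightarrow> total_energy D Th T \<alpha> E' \<phi>' = total_energy D Th T \<alpha> E \<phi>"
    using r(2) by simp
  ultimately show ?thesis
    using source_update_internal_energy[OF pos[rule_format] _ _ upd] by blast
qed

end

section \<open>The plane and spatial products\<close>

interpretation cross2: skew_product cross2
proof
  have "norm (vector [v $ 2, - v $ 1] :: real^2) = norm v" for v :: "real^2"
    by (simp add: norm_vec_def L2_set_def sum_2 add.commute)
  then have "norm (cross2 v w) = norm v * norm w" for v w
    by (simp only: cross2_def norm_scaleR real_norm_def mult.commute)
  then show "\<exists>B. \<forall>v w. norm (cross2 v w) \<le> norm v * norm w * B"
    by (intro exI[of _ 1]) simp
qed (simp_all add: cross2_def vec_eq_iff forall_2 inner_vec_def sum_2 algebra_simps)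

interpretation cross3: skew_product cross3
proof -
  interpret bounded_bilinear cross3
    using bilinear_cross by (simp add: bilinear_conv_bounded_bilinear)
  show "skew_product cross3"
    by unfold_locales (rule dot_cross_self)
qed

theorem corollary4p9:
  fixes \<alpha> \<tau> \<theta> :: real
  assumes "\<alpha> > 0" and "\<tau> > 0" and "1/2 \<le> \<theta>" and "\<theta> \<le> 1"
  shows "(\<forall>(D :: (real^2) set) Th T (\<Omega> :: real^2 \<Rightarrow> real) \<rho> m E \<phi> \<rho>' m' E' \<phi>' \<kappa>.
           open D \<and> D \<noteq> {} \<and> bounded D \<and> simply_connected D \<and> lipschitz_domain D \<and>
           regular_mesh \<kappa> D Th T \<and> cellwise_continuous Th \<Omega> \<and>
           \<rho> \<in> Vh D Th T \<and> m \<in> Vh_vec D Th T \<and> E \<in> Vh D Th T \<and>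
           (\<forall>K\<in>Th. \<forall>x\<in>vertices T K. trace_in K \<rho> x > 0) \<and>
           \<phi> \<in> Hh0 D Th T \<and>
           source_update D Th T cross2 \<Omega> \<alpha> \<tau> \<theta> \<rho> m E \<phi> \<rho>' m' E' \<phi>' \<longrightarrow>
           total_energy D Th T \<alpha> E' \<phi>' \<le> total_energy D Th T \<alpha> E \<phi> \<and>
           (\<theta> = 1/2 \<longrightarrow> total_energy D Th T \<alpha> E' \<phi>' = total_energy D Th T \<alpha> E \<phi>) \<and>
           (\<forall>K\<in>Th. \<forall>x\<in>vertices T K.
              trace_in K \<rho>' x = trace_in K \<rho> x \<and>
              trace_in K E' x - 1/2 * (norm (trace_in K m' x))\<^sup>2 / trace_in K \<rho>' x =
              trace_in K E x - 1/2 * (norm (trace_in K m x))\<^sup>2 / trace_in K \<rho> x)) \<and>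
         (\<forall>(D :: (real^3) set) Th T (\<Omega> :: real^3 \<Rightarrow> real^3) \<rho> m E \<phi> \<rho>' m' E' \<phi>' \<kappa>.
           open D \<and> D \<noteq> {} \<and> bounded D \<and> simply_connected D \<and> lipschitz_domain D \<and>
           regular_mesh \<kappa> D Th T \<and> cellwise_continuous Th \<Omega> \<and>
           \<rho> \<in> Vh D Th T \<and> m \<in> Vh_vec D Th T \<and> E \<in> Vh D Th T \<and>
           (\<forall>K\<in>Th. \<forall>x\<in>vertices T K. trace_in K \<rho> x > 0) \<and>
           \<phi> \<in> Hh0 D Th T \<and>
           source_update D Th T cross3 \<Omega> \<alpha> \<tau> \<theta> \<rho> m E \<phi> \<rho>' m' E' \<phi>' \<longrightarrow>
           total_energy D Th T \<alpha> E' \<phi>' \<le> total_energy D Th T \<alpha> E \<phi> \<and>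
           (\<theta> = 1/2 \<longrightarrow> total_energy D Th T \<alpha> E' \<phi>' = total_energy D Th T \<alpha> E \<phi>) \<and>
           (\<forall>K\<in>Th. \<forall>x\<in>vertices T K.
              trace_in K \<rho>' x = trace_in K \<rho> x \<and>
              trace_in K E' x - 1/2 * (norm (trace_in K m' x))\<^sup>2 / trace_in K \<rho>' x =
              trace_in K E x - 1/2 * (norm (trace_in K m x))\<^sup>2 / trace_in K \<rho> x))"
  by (rule conjI; intro allI impI; elim conjE)
    (rule cross2.source_update_stable[OF assms(1,3)] cross3.source_update_stable[OF assms(1,3)]; assumption)+

end
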